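(* Let $n\ge 2$. Then Jones' $(n-1)$-subgroup $\overrightarrow{F}_{n-1}$ (the set of all reduced $(n-1)$-good diagrams in R. Thompson's group $F$) coincides with $H_n$, the smallest subgroup of $F$ containing $x_0x_1\cdots x_{n-2}$ and closed under the addition $\oplus$.
   Context: $F$ is the group of all piecewise-linear increasing homeomorphisms of $[0,1]$ with all slopes powers of $2$ and all break points of the derivative dyadic fractions; products are composed from left to right: $(gh)(t)=h(g(t))$. Standard generators: $x_0(t)=2t$ on $[0,\frac14]$, $t+\frac14$ on $[\frac14,\frac12]$, $\frac t2+\frac12$ on $[\frac12,1]$; $x_1(t)=t$ on $[0,\frac12]$, $2t-\frac12$ on $[\frac12,\frac58]$, $t+\frac18$ on $[\frac58,\frac34]$, $\frac t2+\frac12$ on $[\frac34,1]$; and $x_{i+1}=x_0^{-i}x_1x_0^{i}$ for $i\ge1$. Addition on $F$: $(a\oplus b)(t)=\frac{a(2t)}2$ for $t\in[0,\frac12]$ and $(a\oplus b)(t)=\frac{b(2t-1)}2+\frac12$ for $t\in[\frac12,1]$. Diagrams: the cell $\pi$ is the plane directed graph whose top path is one edge and whose bottom path consists of two edges, with the same initial and terminal vertices (all edges are directed left to right). Diagrams over $\langle x\mid x=x^2\rangle$ are the plane graphs (up to isotopy) obtained from the single edge $\mathbf 1$ and from $\pi$ by addition $\Delta_1+\Delta_2$ (identify the terminal vertex of $\Delta_1$ with the initial vertex of $\Delta_2$), multiplication $\Delta_1\circ\Delta_2$ (identify the bottom path of $\Delta_1$ with the top path of $\Delta_2$ when they have the same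 length), and inversion (reflection in a horizontal line). A diagram $\Delta$ has an initial vertex $\iota(\Delta)$ and a terminal vertex $\tau(\Delta)$; the other vertices are called inner. A dipole is a subdiagram $\pi\circ\pi^{-1}$ or $\pi^{-1}\circ\pi$; it is eliminated by removing its two cells and identifying its top and bottom paths. A diagram is reduced if it has no dipoles; each diagram is equivalent via dipole moves to a unique reduced diagram. "Diagrams in $F$" are those whose top path and bottom path are single edges; reduced such diagrams, with product = reduced form of $\Delta_1\circ\Delta_2$, form a group identified with $F$ as follows. A reduced $\Delta$ is cut by its longest positive path from $\iota(\Delta)$ to $\tau(\Delta)$ as $\Delta=\Delta^+\circ\Delta^-$, where $\Delta^+$ consists of cells $\pi$ and $\Delta^-$ of cells $\pi^{-1}$. Assign $[0,1]$ to the top edge of $\Delta^+$ and, for each cell, the left and right halves of the interval of its top edge to its left and right bottom edges; the bottom path of $\Delta^+$ gives a dyadic subdivision of $[0,1]$ (top subdivision). Doing the same with $(\Delta^-)^{-1}$ gives the bottom subdivision. $\Delta$ corresponds to the homeomorphism mapping each segment of the top subdivision linearly onto the corresponding segment of the bottom subdivision. Thompson graph $T(\Delta)$: its vertices are all vertices of $\Delta$ except $\tau(\Delta)$; its edges are, for every inner vertex $v$ of $\Delta$, the top-most incoming edge of $v$ in $\Delta$ (upper edge) and the bottom-most incoming edge of $v$ in $\Delta$ (lower edge), counted as two distinct edges if they coincide. The top (resp. bottom) path from $\iota(\Delta)$ to an inner vertex $v$ is the unique positive (left-to-right) path in $T(\Delta)$ from $\iota(\Delta)$ to $v$ composed entirely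 of upper (resp. lower) edges. For a positive integer $m$, $\Delta$ is $m$-good if for every inner vertex $v$ the lengths of the top path and of the bottom path from $\iota(\Delta)$ to $v$ are equal modulo $m$. $\overrightarrow{F}_m$ is the set of all reduced $m$-good diagrams in $F$. *)

theory Defs
  imports
    "HOL-Analysis.Analysis"
    "HOL-Algebra.Group"
    "HOL-Number_Theory.Cong"
    "Graph_Theory.Digraph_Component"
begin

section \<open>Thompson's group F\<close>

text \<open>Homeomorphisms of the unit interval are represented as extensional functions on
  \<^term>\<open>{0..1::real}\<close>, as in HOL-Algebra's group of bijections of a set.\<close>

definition dyadic :: "real \<Rightarrow> bool" where
  "dyadic t \<longleftrightarrow> (\<exists>(m::int) (k::nat). t = of_int m / 2 ^ k)"

text \<open>The break points of the derivative are among the points of the subdivision \<open>ps\<close>, so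
  \<open>ps\<close> can be chosen dyadic iff all of them are dyadic.\<close>

definition dyadic_piecewise_linear :: "(real \<Rightarrow> real) \<Rightarrow> bool" where
  "dyadic_piecewise_linear f \<longleftrightarrow>
    (\<exists>ps. ps \<noteq> [] \<and> sorted_wrt (<) ps \<and> hd ps = 0 \<and> last ps = 1 \<and> (\<forall>p\<in>set ps. dyadic p) \<and>
      (\<forall>i. Suc i < length ps \<longrightarrow>
        (\<exists>(k::int) c. \<forall>t\<in>{ps ! i..ps ! Suc i}. f t = 2 powi k * t + c)))"

text \<open>Products are composed from left to right.\<close>

definition thompson_F :: "(real \<Rightarrow> real) monoid" where
  "thompson_F =
    \<lparr>carrier = {f \<in> extensional {0..1}. strict_mono_on {0..1} f \<and>
        (\<exists>g. homeomorphism {0..1} {0..1} f g) \<and> dyadic_piecewise_linear f},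
     mult = \<lambda>g h. compose {0..1} h g,
     one = \<lambda>t\<in>{0..1}. t\<rparr>"

definition F_x0 :: "real \<Rightarrow> real" where
  "F_x0 = (\<lambda>t\<in>{0..1}. if t \<le> 1/4 then 2 * t else if t \<le> 1/2 then t + 1/4 else t/2 + 1/2)"

definition F_x1 :: "real \<Rightarrow> real" where
  "F_x1 = (\<lambda>t\<in>{0..1}. if t \<le> 1/2 then t else if t \<le> 5/8 then 2 * t - 1/2
      else if t \<le> 3/4 then t + 1/8 else t/2 + 1/2)"

text \<open>For \<open>i = 0\<close> the second equation gives \<open>F_gen 1 = F_x1\<close>.\<close>

fun F_gen :: "nat \<Rightarrow> real \<Rightarrow> real" where
  "F_gen 0 = F_x0"
| "F_gen (Suc i) = F_x0 [^]\<^bsub>thompson_F\<^esub> (- int i) \<otimes>\<^bsub>thompson_F\<^esub> F_x1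
      \<otimes>\<^bsub>thompson_F\<^esub> F_x0 [^]\<^bsub>thompson_F\<^esub> int i"

definition F_gen_prod :: "nat \<Rightarrow> real \<Rightarrow> real" where
  "F_gen_prod k = foldr (\<otimes>\<^bsub>thompson_F\<^esub>) (map F_gen [0..<Suc k]) \<one>\<^bsub>thompson_F\<^esub>"

definition F_add :: "(real \<Rightarrow> real) \<Rightarrow> (real \<Rightarrow> real) \<Rightarrow> real \<Rightarrow> real" where
  "F_add a b = (\<lambda>t\<in>{0..1}. if t \<le> 1/2 then a (2 * t) / 2 else b (2 * t - 1) / 2 + 1/2)"

text \<open>The smallest subgroup containing \<open>x\<^sub>0 x\<^sub>1 \<dots> x\<^bsub>n-2\<^esub>\<close> and closed under addition.\<close>

definition H_group :: "nat \<Rightarrow> (real \<Rightarrow> real) set" where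
  "H_group n = \<Inter> {H. subgroup H thompson_F \<and> F_gen_prod (n - 2) \<in> H \<and>
      (\<forall>a\<in>H. \<forall>b\<in>H. F_add a b \<in> H)}"


section \<open>Diagrams\<close>

text \<open>A plane diagram is recorded, up to isotopy, by its directed graph, its cells, and its top and
  bottom paths. A cell is the pair of its top and bottom paths, all paths being lists of edges.\<close>

record ('v, 'e) diag =
  dgraph :: "('v, 'e) pre_digraph"
  dcells :: "('e list \<times> 'e list) set"
  dtop :: "'e list"
  dbot :: "'e list"

definition dinit :: "('v, 'e) diag \<Rightarrow> 'v" where
  "dinit D = tail (dgraph D) (hd (dtop D))"

definition dterm :: "('v, 'e) diag \<Rightarrow> 'v" where
  "dterm D = head (dgraph D) (last (dtop D))"

definition path_verts :: "('v, 'e) diag \<Rightarrow> 'e list \<Rightarrow> 'v set" where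
  "path_verts D p = set (pre_digraph.awalk_verts (dgraph D) (dinit D) p)"

text \<open>Gluing: the two diagrams are given by representatives that already share exactly
  the vertices and edges to be identified, so that the result is their union. Since names of
  vertices and edges can be chosen freely, every gluing is of this form. The library predicate
  \<^const>\<open>compatible\<close> says that tails and heads of edges agree.\<close>

definition summable_diags :: "('v, 'e) diag \<Rightarrow> ('v, 'e) diag \<Rightarrow> bool" where
  "summable_diags D1 D2 \<longleftrightarrow> compatible (dgraph D1) (dgraph D2) \<and> dterm D1 = dinit D2 \<and>
    verts (dgraph D1) \<inter> verts (dgraph D2) = {dterm D1} \<and>
    arcs (dgraph D1) \<inter> arcs (dgraph D2) = {}"

definition dsum :: "('v, 'e) diag \<Rightarrow> ('v, 'e) diag \<Rightarrow> ('v, 'e) diag" where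
  "dsum D1 D2 = \<lparr>dgraph = Digraph_Component.union (dgraph D1) (dgraph D2),
    dcells = dcells D1 \<union> dcells D2, dtop = dtop D1 @ dtop D2, dbot = dbot D1 @ dbot D2\<rparr>"

definition composable_diags :: "('v, 'e) diag \<Rightarrow> ('v, 'e) diag \<Rightarrow> bool" where
  "composable_diags D1 D2 \<longleftrightarrow> compatible (dgraph D1) (dgraph D2) \<and> dbot D1 = dtop D2 \<and>
    verts (dgraph D1) \<inter> verts (dgraph D2) = path_verts D1 (dbot D1) \<and>
    arcs (dgraph D1) \<inter> arcs (dgraph D2) = set (dbot D1)"

definition dcomp :: "('v, 'e) diag \<Rightarrow> ('v, 'e) diag \<Rightarrow> ('v, 'e) diag" where
  "dcomp D1 D2 = \<lparr>dgraph = Digraph_Component.union (dgraph D1) (dgraph D2),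
    dcells = dcells D1 \<union> dcells D2, dtop = dtop D1, dbot = dbot D2\<rparr>"

definition dinv :: "('v, 'e) diag \<Rightarrow> ('v, 'e) diag" where
  "dinv D = \<lparr>dgraph = dgraph D, dcells = (\<lambda>(p, q). (q, p)) ` dcells D,
    dtop = dbot D, dbot = dtop D\<rparr>"

inductive diagram :: "('v, 'e) diag \<Rightarrow> bool" where
  edge: "t e \<noteq> h e \<Longrightarrow>
    diagram \<lparr>dgraph = \<lparr>verts = {t e, h e}, arcs = {e}, tail = t, head = h\<rparr>,
      dcells = {}, dtop = [e], dbot = [e]\<rparr>"
| pi: "\<lbrakk>distinct [u, v, w]; distinct [e, e1, e2];
      t e = u; h e = w; t e1 = u; h e1 = v; t e2 = v; h e2 = w\<rbrakk> \<Longrightarrow>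
    diagram \<lparr>dgraph = \<lparr>verts = {u, v, w}, arcs = {e, e1, e2}, tail = t, head = h\<rparr>,
      dcells = {([e], [e1, e2])}, dtop = [e], dbot = [e1, e2]\<rparr>"
| sum: "\<lbrakk>diagram D1; diagram D2; summable_diags D1 D2\<rbrakk> \<Longrightarrow> diagram (dsum D1 D2)"
| comp: "\<lbrakk>diagram D1; diagram D2; composable_diags D1 D2\<rbrakk> \<Longrightarrow> diagram (dcomp D1 D2)"
| inv: "diagram D \<Longrightarrow> diagram (dinv D)"

definition diagram_in_F :: "('v, 'e) diag \<Rightarrow> bool" where
  "diagram_in_F D \<longleftrightarrow> diagram D \<and> length (dtop D) = 1 \<and> length (dbot D) = 1"

text \<open>The two disjuncts are the dipoles \<open>\<pi> \<circ> \<pi>\<^sup>-\<^sup>1\<close> and \<open>\<pi>\<^sup>-\<^sup>1 \<circ> \<pi>\<close>.\<close>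

definition has_dipole :: "('v, 'e) diag \<Rightarrow> bool" where
  "has_dipole D \<longleftrightarrow>
    (\<exists>e e1 e2 e'. ([e], [e1, e2]) \<in> dcells D \<and> ([e1, e2], [e']) \<in> dcells D) \<or>
    (\<exists>e e1 e2 e1' e2'. ([e1, e2], [e]) \<in> dcells D \<and> ([e], [e1', e2']) \<in> dcells D)"

definition reduced :: "('v, 'e) diag \<Rightarrow> bool" where
  "reduced D \<longleftrightarrow> \<not> has_dipole D"


section \<open>The homeomorphism of a reduced diagram\<close>

text \<open>Walks in the directed graph of a diagram are exactly its positive paths.\<close>

definition longest_positive_path :: "('v, 'e) diag \<Rightarrow> 'e list \<Rightarrow> bool" where
  "longest_positive_path D p \<longleftrightarrow>
    pre_digraph.awalk (dgraph D) (dinit D) p (dterm D) \<and>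
    (\<forall>q. pre_digraph.awalk (dgraph D) (dinit D) q (dterm D) \<longrightarrow> length q \<le> length p)"

definition diagram_cut :: "('v, 'e) diag \<Rightarrow> ('v, 'e) diag \<Rightarrow> ('v, 'e) diag \<Rightarrow> bool" where
  "diagram_cut D Dp Dm \<longleftrightarrow> diagram Dp \<and> diagram Dm \<and> composable_diags Dp Dm \<and>
    D = dcomp Dp Dm \<and> longest_positive_path D (dbot Dp)"

text \<open>\<open>assigned D e a b\<close>: the edge \<open>e\<close> is assigned the interval \<^term>\<open>{a..b}\<close>.\<close>

inductive assigned :: "('v, 'e) diag \<Rightarrow> 'e \<Rightarrow> real \<Rightarrow> real \<Rightarrow> bool" for D where
  top: "dtop D = [e] \<Longrightarrow> assigned D e 0 1"
| left: "\<lbrakk>assigned D e a b; ([e], [e1, e2]) \<in> dcells D\<rbrakk> \<Longrightarrow> assigned D e1 a ((a + b) / 2)"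
| right: "\<lbrakk>assigned D e a b; ([e], [e1, e2]) \<in> dcells D\<rbrakk> \<Longrightarrow> assigned D e2 ((a + b) / 2) b"

text \<open>The bottom path of \<open>Dp\<close> is also the top path of \<open>Dm\<close>, i.e. the bottom path of
  \<open>dinv Dm\<close>; its \<open>i\<close>-th edge therefore carries the \<open>i\<close>-th segments of both subdivisions.\<close>

definition corresponds :: "('v, 'e) diag \<Rightarrow> (real \<Rightarrow> real) \<Rightarrow> bool" where
  "corresponds D f \<longleftrightarrow> f \<in> extensional {0..1} \<and>
    (\<exists>Dp Dm. diagram_cut D Dp Dm \<and>
      (\<forall>e\<in>set (dbot Dp). \<exists>a b c d. assigned Dp e a b \<and> assigned (dinv Dm) e c d \<and>
        (\<forall>t\<in>{a..b}. f t = c + (d - c) / (b - a) * (t - a))))"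


section \<open>The Thompson graph and Jones' subgroups\<close>

definition inner_verts :: "('v, 'e) diag \<Rightarrow> 'v set" where
  "inner_verts D = verts (dgraph D) - {dinit D, dterm D}"

text \<open>Two incoming edges of a vertex \<open>v\<close> are consecutive in the top-to-bottom order around \<open>v\<close>
  iff they are the last edges of the top and the bottom path of a cell with terminal
  vertex \<open>v\<close>.\<close>

definition above :: "('v, 'e) diag \<Rightarrow> ('e \<times> 'e) set" where
  "above D = {(last p, last q) | p q. (p, q) \<in> dcells D}\<^sup>*"

definition upper_edge :: "('v, 'e) diag \<Rightarrow> 'v \<Rightarrow> 'e" where
  "upper_edge D v = (THE e. e \<in> in_arcs (dgraph D) v \<and>
      (\<forall>e'\<in>in_arcs (dgraph D) v. (e, e') \<in> above D))"

definition lower_edge :: "('v, 'e) diag \<Rightarrow> 'v \<Rightarrow> 'e" where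
  "lower_edge D v = (THE e. e \<in> in_arcs (dgraph D) v \<and>
      (\<forall>e'\<in>in_arcs (dgraph D) v. (e', e) \<in> above D))"

text \<open>Tagging the edges with a side keeps upper and lower edges distinct.\<close>

datatype side = Upper | Lower

definition thompson_graph :: "('v, 'e) diag \<Rightarrow> ('v, side \<times> 'e) pre_digraph" where
  "thompson_graph D =
    \<lparr>verts = verts (dgraph D) - {dterm D},
     arcs = (\<lambda>v. (Upper, upper_edge D v)) ` inner_verts D \<union>
            (\<lambda>v. (Lower, lower_edge D v)) ` inner_verts D,
     tail = tail (dgraph D) \<circ> snd,
     head = head (dgraph D) \<circ> snd\<rparr>"

text \<open>\<open>side_path D Upper v\<close> is the top path and \<open>side_path D Lower v\<close> the bottom path from the
  initial vertex to \<open>v\<close>.\<close>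

definition side_path :: "('v, 'e) diag \<Rightarrow> side \<Rightarrow> 'v \<Rightarrow> (side \<times> 'e) list" where
  "side_path D s v = (THE p. pre_digraph.awalk (thompson_graph D) (dinit D) p v \<and>
      (\<forall>a\<in>set p. fst a = s))"

definition good :: "nat \<Rightarrow> ('v, 'e) diag \<Rightarrow> bool" where
  "good m D \<longleftrightarrow> (\<forall>v\<in>inner_verts D.
      [length (side_path D Upper v) = length (side_path D Lower v)] (mod m))"

text \<open>Reduced diagrams are identified with the homeomorphisms they correspond to. Diagrams are
  finite, so every diagram has a representative whose vertices and edges are natural numbers.\<close>

definition jones_subgroup :: "nat \<Rightarrow> (real \<Rightarrow> real) set" where
  "jones_subgroup m = {f. \<exists>D :: (nat, nat) diag.
      diagram_in_F D \<and> reduced D \<and> good m D \<and> corresponds D f}"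

end

theory Submission
  imports Defs
begin

text \<open>
  Put \<open>m = n - 1\<close>. Both sides are shown to be the group \<open>tree_group m\<close> of those homeomorphisms that
  are given by a pair of binary trees \<open>S\<close>, \<open>T\<close> with equally many leaves such that the \<open>i\<close>-th leaf of \<open>S\<close>
  and the \<open>i\<close>-th leaf of \<open>T\<close> are reached by numbers of right turns that are congruent modulo \<open>m\<close>.
  The number of right turns to a leaf is its label; it is the number of ones in the binary expansion
  of the left end point of the interval that the leaf stands for.

  On the side of diagrams, a reduced diagram consists of a tree of cells \<open>\<pi>\<close> above a tree of
  cells \<open>\<pi>\<^sup>-\<^sup>1\<close>, and its vertices are the division points between consecutive leaves. The topmost
  edge into the vertex between two consecutive leaves is the last left child on the way to the first of
  them, since only right turns follow it. This edge starts at the first leaf below it, whose label is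
  smaller by one than the label of the second of the two leaves. Therefore the top path to a vertex is
  as long as the label of the leaf that starts there (\<open>topmost_edge\<close>, \<open>length_side_path\<close>). By symmetry the bottom path gives the labels of the lower tree, and a diagram
  is \<open>m\<close>-good iff the two label sequences are congruent (\<open>good_iff\<close>). Conversely, a tree
  pair with the smallest possible number of leaves yields a reduced diagram, because a dipole would be
  a caret that can be removed from both trees (\<open>dipole_common_caret\<close>).

  On the side of generators, the element \<open>x\<^sub>0 x\<^sub>1 \<dots> x\<^bsub>m-1\<^esub>\<close> is the tree pair of the law
  \<open>(a\<^sub>1 (a\<^sub>2 \<dots> (a\<^sub>m b))) c = a\<^sub>1 (a\<^sub>2 \<dots> (a\<^sub>m (b c)))\<close>
  of \<open>m\<close>-associativity with all variables replaced by leaves. Subdividing the leaves of a tree pair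
  does not change the homeomorphism, so a subgroup that contains this element contains all
  substitution instances of the law; products express transitivity and \<open>\<oplus>\<close> expresses
  compatibility with forming binary trees. Hence \<open>H\<^sub>n\<close> contains every tree pair that follows from
  the law (\<open>assoc_in_subgroup\<close>). The law preserves labels modulo \<open>m\<close>, and it is complete for them
  (\<open>assoc_iff_labels\<close>): every tree can be rewritten into a normal form, which its labels modulo \<open>m\<close>
  determine.
\<close>

section \<open>Bracketings and m-associativity\<close>

datatype btree = Tip | Fork btree btree

text \<open>Leaves are addressed by the turns that lead to them from the root; \<open>True\<close> is a right turn.\<close>

fun addr :: "btree \<Rightarrow> bool list list" where
  "addr Tip = [[]]"
| "addr (Fork l r) = map ((#) False) (addr l) @ map ((#) True) (addr r)"

definition ones :: "bool list \<Rightarrow> nat" where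
  "ones w = length (filter id w)"

definition labels :: "btree \<Rightarrow> nat list" where
  "labels T = map ones (addr T)"

text \<open>Right combs \<open>a\<^sub>1 (a\<^sub>2 \<dots> (a\<^sub>k T))\<close>; they occur on both sides of the associativity law.\<close>

definition comb :: "btree list \<Rightarrow> btree \<Rightarrow> btree" where
  "comb as T = foldr Fork as T"

lemma comb_simps [simp]: "comb [] T = T" "comb (a # as) T = Fork a (comb as T)"
  by (simp_all add: comb_def)

lemma ones_simps [simp]:
  "ones [] = 0" "ones (True # w) = Suc (ones w)" "ones (False # w) = ones w"
  "ones (v @ w) = ones v + ones w"
  by (simp_all add: ones_def)

lemma labels_simps [simp]:
  "labels Tip = [0]" "labels (Fork l r) = labels l @ map Suc (labels r)"
  by (simp_all add: labels_def)

lemma addr_not_Nil [simp]: "addr T \<noteq> []"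
  by (induction T) auto

lemma labels_not_Nil [simp]: "labels T \<noteq> []"
  by (simp add: labels_def)

lemma length_labels [simp]: "length (labels T) = length (addr T)"
  by (simp add: labels_def)

lemma hd_labels [simp]: "hd (labels T) = 0"
  by (induction T) auto

lemma tl_labels_pos: "x \<in> set (tl (labels T)) \<Longrightarrow> x > 0"
  by (induction T) auto

lemma labels_Cons: "\<exists>xs. labels T = 0 # xs \<and> (\<forall>x\<in>set xs. x > 0)"
  using tl_labels_pos[of _ T] hd_labels[of T] labels_not_Nil[of T] by (metis list.collapse)

text \<open>The first leaf of the right subtree is the last leaf with label 1, because all later leaves
  are reached by a further right turn. So the labels show where to split, and the tree can be
  reconstructed recursively.\<close>

lemma labels_inj: "labels S = labels T \<Longrightarrow> S = T"
proof (induction S arbitrary: T)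
  case Tip
  then show ?case
  proof (cases T)
    case (Fork l r)
    have "length (labels l) > 0" "length (labels r) > 0" by (simp_all del: length_labels)
    moreover have "length (labels l) + length (labels r) = 1"
      using arg_cong[OF Tip, of length] Fork by (simp del: length_labels)
    ultimately show ?thesis by linarith
  qed simp
next
  case (Fork l r)
  have split: "us = []" if "us @ map Suc (labels r) = map Suc (labels r')" for us r r'
  proof (rule ccontr)
    assume "us \<noteq> []"
    obtain xs where r: "labels r = 0 # xs" using labels_Cons by blast
    obtain ys where r': "labels r' = 0 # ys" and ys: "\<forall>y\<in>set ys. y > 0" using labels_Cons by blast
    have "tl us @ 1 # map Suc xs = map Suc ys"
      using that \<open>us \<noteq> []\<close> r r' by (cases us) auto
    then have "1 \<in> set (map Suc ys)" by (metis in_set_conv_decomp)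
    then show False using ys by auto
  qed
  show ?case
  proof (cases T)
    case Tip
    have "length (labels l) > 0" "length (labels r) > 0" by (simp_all del: length_labels)
    moreover have "length (labels l) + length (labels r) = 1"
      using arg_cong[OF Fork.prems, of length] Tip by (simp del: length_labels)
    ultimately show ?thesis by linarith
  next
    case [simp]: (Fork l' r')
    have "labels l @ map Suc (labels r) = labels l' @ map Suc (labels r')"
      using Fork.prems by simp
    then obtain us where "labels l = labels l' @ us \<and> us @ map Suc (labels r) = map Suc (labels r')
        \<or> labels l @ us = labels l' \<and> map Suc (labels r) = us @ map Suc (labels r')"
      by (auto simp: append_eq_append_conv2)
    then have "labels l = labels l'" "map Suc (labels r) = map Suc (labels r')"
      using split by (metis append_Nil append_Nil2)+
    then show ?thesis using Fork.IH by (simp add: inj_map_eq_map)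
  qed
qed

text \<open>The equational theory of the law of \<open>m\<close>-associativity on bracketings.\<close>

inductive assoc :: "nat \<Rightarrow> btree \<Rightarrow> btree \<Rightarrow> bool" for m where
  refl: "assoc m T T"
| sym: "assoc m S T \<Longrightarrow> assoc m T S"
| trans: "assoc m S T \<Longrightarrow> assoc m T U \<Longrightarrow> assoc m S U"
| fork: "assoc m S S' \<Longrightarrow> assoc m T T' \<Longrightarrow> assoc m (Fork S T) (Fork S' T')"
| shift: "length as = m \<Longrightarrow> assoc m (Fork (comb as S) T) (comb as (Fork S T))"

definition cong_lists :: "nat \<Rightarrow> nat list \<Rightarrow> nat list \<Rightarrow> bool" where
  "cong_lists m = list_all2 (\<lambda>x y. [x = y] (mod m))"

lemma cong_lists_refl [simp]: "cong_lists m xs xs"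
  by (auto simp: cong_lists_def list_all2_conv_all_nth)

lemma cong_lists_sym: "cong_lists m xs ys \<Longrightarrow> cong_lists m ys xs"
  unfolding cong_lists_def list_all2_conv_all_nth by (metis cong_sym)

lemma cong_lists_trans: "cong_lists m xs ys \<Longrightarrow> cong_lists m ys zs \<Longrightarrow> cong_lists m xs zs"
  unfolding cong_lists_def by (rule list_all2_trans) (rule cong_trans)

lemma cong_lists_append:
  "cong_lists m xs ys \<Longrightarrow> cong_lists m xs' ys' \<Longrightarrow> cong_lists m (xs @ xs') (ys @ ys')"
  by (auto simp: cong_lists_def intro: list_all2_appendI)

lemma cong_lists_map_add:
  assumes "[a = b] (mod m)" "cong_lists m xs ys"
  shows "cong_lists m (map ((+) a) xs) (map ((+) b) ys)"
  using assms by (auto simp: cong_lists_def list_all2_conv_all_nth intro: cong_add)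

lemma cong_lists_map_Suc: "cong_lists m xs ys \<Longrightarrow> cong_lists m (map Suc xs) (map Suc ys)"
  using cong_lists_map_add[of 1 1 m xs ys] unfolding plus_1_eq_Suc by simp

lemma labels_comb:
  "\<exists>us. \<forall>T. labels (comb as T) = us @ map ((+) (length as)) (labels T)"
proof (induction as)
  case (Cons a as)
  then obtain us where "\<forall>T. labels (comb as T) = us @ map ((+) (length as)) (labels T)" by blast
  then have "\<forall>T. labels (comb (a # as) T)
      = (labels a @ map Suc us) @ map ((+) (length (a # as))) (labels T)"
    by simp
  then show ?case by blast
qed (auto simp: map_idI)

text \<open>In an instance of the law only the leaves of \<open>T\<close> change their labels, from \<open>1 + x\<close> to
  \<open>m + 1 + x\<close>.\<close>

lemma assoc_labels: "assoc m S T \<Longrightarrow> cong_lists m (labels S) (labels T)"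
proof (induction rule: assoc.induct)
  case (shift as S T)
  obtain us where us: "\<And>T. labels (comb as T) = us @ map ((+) (length as)) (labels T)"
    using labels_comb by blast
  have "[1 = Suc m] (mod m)" by (metis cong_def mod_add_self2 plus_1_eq_Suc)
  then have "cong_lists m (map Suc (labels T)) (map ((+) (Suc m)) (labels T))"
    using cong_lists_map_add[of 1 "Suc m" m "labels T" "labels T"] unfolding plus_1_eq_Suc by simp
  then have "cong_lists m (us @ map ((+) m) (labels S) @ map Suc (labels T))
      (us @ map ((+) m) (labels S) @ map ((+) (Suc m)) (labels T))"
    by (intro cong_lists_append cong_lists_refl)
  moreover have "(\<lambda>x. Suc (m + x)) = (+) (Suc m)" by auto
  ultimately show ?case by (simp add: us shift comp_def)
qed (simp_all add: cong_lists_sym cong_lists_append cong_lists_map_Suc, rule cong_lists_trans)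

text \<open>The law moves subtrees out of left children whose right spine is long. In a normal form
  every left child has a right spine of length below \<open>m\<close>.\<close>

fun spine :: "btree \<Rightarrow> nat" where
  "spine Tip = 0"
| "spine (Fork l r) = Suc (spine r)"

fun normal :: "nat \<Rightarrow> btree \<Rightarrow> bool" where
  "normal m Tip = True"
| "normal m (Fork l r) = (spine l < m \<and> normal m l \<and> normal m r)"

lemma spine_ge_comb: "k \<le> spine T \<Longrightarrow> \<exists>as S. T = comb as S \<and> length as = k"
proof (induction k arbitrary: T)
  case (Suc k)
  then obtain l r where T: "T = Fork l r" by (cases T) auto
  then obtain as S where "r = comb as S" "length as = k" using Suc by force
  then have "T = comb (l # as) S \<and> length (l # as) = Suc k" using T by simp
  then show ?case by blast
qed auto

lemma normal_comb:
  "normal m (comb as T) \<longleftrightarrow> (\<forall>a\<in>set as. normal m a \<and> spine a < m) \<and> normal m T"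
  by (induction as) auto

lemma assoc_comb: "assoc m S T \<Longrightarrow> assoc m (comb as S) (comb as T)"
  by (induction as) (auto intro: assoc.fork assoc.refl)

lemma size_comb: "size (comb as T) \<ge> size T + length as"
  by (induction as) auto

text \<open>A right spine of length at least \<open>m\<close> in the left child lets the law peel off its first \<open>m\<close>
  left subtrees. What remains of the left child is smaller, which ends the recursion.\<close>

lemma normal_form_Fork:
  assumes "m > 0" "normal m l" "normal m r"
  shows "\<exists>N. normal m N \<and> assoc m (Fork l r) N"
  using assms(2)
proof (induction l rule: measure_induct_rule[of size])
  case (less l)
  show ?case
  proof (cases "spine l < m")
    case True
    then show ?thesis using less.prems assms by (intro exI[of _ "Fork l r"]) (auto intro: assoc.refl)
  next
    case False
    then obtain as S where l: "l = comb as S" "length as = m" using spine_ge_comb[of m l] by auto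
    have "size S < size l" using size_comb[of S as] l assms(1) by simp
    moreover have "normal m S" using less.prems l by (simp add: normal_comb)
    ultimately obtain N where N: "normal m N" "assoc m (Fork S r) N" using less.IH by blast
    have "assoc m (Fork l r) (comb as N)"
      unfolding l(1) using assoc.shift[OF l(2)] assoc_comb[OF N(2)] by (rule assoc.trans)
    moreover have "normal m (comb as N)" using less.prems l N by (simp add: normal_comb)
    ultimately show ?thesis by blast
  qed
qed

lemma normal_form_exists: "m > 0 \<Longrightarrow> \<exists>N. normal m N \<and> assoc m T N"
proof (induction T)
  case Tip
  then show ?case by (intro exI[of _ Tip]) (auto intro: assoc.refl)
next
  case (Fork l r)
  then obtain L R where "normal m L" "assoc m l L" "normal m R" "assoc m r R" by blast
  then show ?case using normal_form_Fork[OF Fork.prems, of L R] assoc.fork assoc.trans by meson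
qed

lemma last_labels: "last (labels T) = spine T"
  by (induction T) (auto simp: last_map)

text \<open>Two consecutive leaves have addresses of the form \<open>u 0 1\<^sup>p\<close> and \<open>u 1 0\<^sup>q\<close>. So the labels
  increase by \<open>1 - p\<close>, where \<open>p\<close> is the length of the right spine of a left child, and \<open>p < m\<close> in a normal
  form.\<close>

lemma normal_labels_step:
  "normal m T \<Longrightarrow> successively (\<lambda>x y. y \<le> Suc x \<and> Suc x < y + m) (labels T)"
proof (induction T)
  case (Fork l r)
  then show ?case
    by (auto simp: successively_append_iff successively_map last_labels hd_map)
qed auto

text \<open>Successive labels of a normal form lie in a window of length \<open>m\<close> determined by the previous
  label, so they are determined by their residues modulo \<open>m\<close>.\<close>

lemma cong_lists_step_unique:
  assumes "successively (\<lambda>x y. y \<le> Suc x \<and> Suc x < y + m) (a # xs)"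
    and "successively (\<lambda>x y. y \<le> Suc x \<and> Suc x < y + m) (a # ys)"
    and "cong_lists m xs ys"
  shows "xs = ys"
  using assms
proof (induction xs arbitrary: a ys)
  case (Cons x xs)
  obtain y ys' where ys: "ys = y # ys'" "[x = y] (mod m)" "cong_lists m xs ys'"
    using Cons.prems(3) by (auto simp: cong_lists_def list_all2_Cons1)
  have "x \<le> Suc a" "Suc a < x + m" "y \<le> Suc a" "Suc a < y + m" using Cons.prems ys by auto
  then have "\<bar>int x - int y\<bar> < int m" by linarith
  moreover have "int m dvd int x - int y"
    using ys(2) by (metis cong_iff_dvd_diff cong_int_iff)
  ultimately have "x = y" by (metis zdvd_not_zless abs_0_eq abs_ge_zero dvd_abs_iff eq_iff_diff_eq_0 of_nat_eq_iff order_le_less)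
  then show ?case using Cons ys by (auto simp: successively_Cons)
qed (auto simp: cong_lists_def)

text \<open>Completeness: trees with congruent labels have normal forms with equal labels, hence the
  same normal form.\<close>

lemma assoc_iff_labels:
  assumes "m > 0"
  shows "assoc m S T \<longleftrightarrow> cong_lists m (labels S) (labels T)"
proof
  assume c: "cong_lists m (labels S) (labels T)"
  obtain M N where MN: "normal m M" "assoc m S M" "normal m N" "assoc m T N"
    using normal_form_exists[OF assms] by meson
  have MNc: "cong_lists m (labels M) (labels N)"
    using c MN by (meson assoc_labels cong_lists_sym cong_lists_trans)
  obtain xs ys where xs: "labels M = 0 # xs" and ys: "labels N = 0 # ys" using labels_Cons by blast
  have "xs = ys"
    using normal_labels_step[OF MN(1)] normal_labels_step[OF MN(3)] MNc unfolding xs ys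
    by (intro cong_lists_step_unique[of m 0 xs ys]) (auto simp: cong_lists_def)
  then have "M = N" using xs ys by (intro labels_inj) simp
  then show "assoc m S T" using MN by (metis assoc.sym assoc.trans)
qed (rule assoc_labels)

section \<open>Elements of F as pairs of trees\<close>

text \<open>The affine map of the unit interval onto the dyadic interval with the given address.\<close>

fun act :: "bool list \<Rightarrow> real \<Rightarrow> real" where
  "act [] t = t"
| "act (b # w) t = (act w t + of_bool b) / 2"

lemma act_append: "act (v @ w) t = act v (act w t)"
  by (induction v) auto

lemma act_affine: "act w t = act w 0 + t / 2 ^ length w"
  by (induction w) (auto simp: field_simps)

lemma act_bounds: "t \<in> {0..1} \<Longrightarrow> act w t \<in> {0..1}"
  by (induction w) auto

lemma act_less_iff [simp]: "act w s < act w t \<longleftrightarrow> s < t"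
  using act_affine[of w s] act_affine[of w t] by (simp add: divide_less_cancel)

lemma act_le_iff [simp]: "act w s \<le> act w t \<longleftrightarrow> s \<le> t"
  by (simp add: not_less[symmetric])

lemma act_eq_iff [simp]: "act w s = act w t \<longleftrightarrow> s = t"
  by (simp add: order_eq_iff)

lemma act_between:
  assumes "act w 0 \<le> x" "x \<le> act w 1"
  obtains t where "t \<in> {0..1}" "x = act w t"
proof
  let ?t = "(x - act w 0) * 2 ^ length w"
  show x: "x = act w ?t" using act_affine[of w ?t] by simp
  show "?t \<in> {0..1}"
    using assms act_le_iff[of w 0 ?t] act_le_iff[of w ?t 1] unfolding x[symmetric] by simp
qed

lemma addr_cover:
  assumes "x \<in> {0..1}"
  shows "\<exists>w\<in>set (addr T). \<exists>t\<in>{0..1}. x = act w t \<and> (x < 1 \<longrightarrow> t < 1)"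
  using assms
proof (induction T arbitrary: x)
  case (Fork l r)
  show ?case
  proof (cases "x < 1/2")
    case True
    then obtain w t where "w \<in> set (addr l)" "t \<in> {0..1}" "2 * x = act w t" "t < 1"
      using Fork.IH(1)[of "2 * x"] Fork.prems by force
    then show ?thesis by (intro bexI[of _ "False # w"] bexI[of _ t]) auto
  next
    case False
    then obtain w t where "w \<in> set (addr r)" "t \<in> {0..1}" "2 * x - 1 = act w t" "x < 1 \<longrightarrow> t < 1"
      using Fork.IH(2)[of "2 * x - 1"] Fork.prems by force
    then show ?thesis by (intro bexI[of _ "True # w"] bexI[of _ t]) (auto simp: field_simps)
  qed
qed auto

lemma addr_sorted: "sorted_wrt (\<lambda>v w. act v 1 \<le> act w 0) (addr T)"
proof (induction T)
  case (Fork l r)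
  have "act v 1 \<le> 1" "0 \<le> act v 0" for v
    using act_bounds[of 1 v] act_bounds[of 0 v] by auto
  then have "(act v 1 + 0) / 2 \<le> (act w 0 + 1) / 2" for v w
    by (metis add.right_neutral add_increasing add_mono divide_right_mono zero_le_numeral)
  then show ?case using Fork by (auto simp: sorted_wrt_append sorted_wrt_map divide_right_mono)
qed auto

lemma act_hd_addr: "act (hd (addr T)) 0 = 0"
  by (induction T) (auto simp: hd_map)

lemma act_last_addr: "act (last (addr T)) 1 = 1"
  by (induction T) (auto simp: last_map)

lemma addr_contiguous: "successively (\<lambda>v w. act v 1 = act w 0) (addr T)"
  by (induction T)
    (auto simp: successively_append_iff successively_map hd_map last_map act_hd_addr act_last_addr)

text \<open>The condition on one pair of corresponding leaves. For \<open>m = 1\<close> the congruence always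
  holds, so that case describes arbitrary tree pairs.\<close>

definition leaf_map :: "nat \<Rightarrow> (real \<Rightarrow> real) \<Rightarrow> bool list \<Rightarrow> bool list \<Rightarrow> bool" where
  "leaf_map m f v w \<longleftrightarrow> (\<forall>t\<in>{0..1}. f (act v t) = act w t) \<and> [ones v = ones w] (mod m)"

definition tree_rep :: "nat \<Rightarrow> (real \<Rightarrow> real) \<Rightarrow> btree \<Rightarrow> btree \<Rightarrow> bool" where
  "tree_rep m f S T \<longleftrightarrow> f \<in> extensional {0..1} \<and> list_all2 (leaf_map m f) (addr S) (addr T)"

definition tree_group :: "nat \<Rightarrow> (real \<Rightarrow> real) set" where
  "tree_group m = {f. \<exists>S T. tree_rep m f S T}"

abbreviation tips :: "btree \<Rightarrow> nat" where
  "tips T \<equiv> length (addr T)"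

lemma tree_rep_tips: "tree_rep m f S T \<Longrightarrow> tips S = tips T"
  by (auto simp: tree_rep_def list_all2_lengthD)

lemma tree_rep_iff_labels:
  "tree_rep m f S T \<longleftrightarrow> tree_rep 1 f S T \<and> cong_lists m (labels S) (labels T)"
  by (auto simp: tree_rep_def leaf_map_def cong_lists_def labels_def list_all2_conv_all_nth)

lemma tree_rep_nth:
  "tree_rep m f S T \<Longrightarrow> i < tips S \<Longrightarrow> t \<in> {0..1} \<Longrightarrow> f (act (addr S ! i) t) = act (addr T ! i) t"
  by (auto simp: tree_rep_def leaf_map_def list_all2_conv_all_nth)

lemma tree_rep_piece:
  assumes "tree_rep m f S T" "x \<in> {0..1}"
  obtains i t where "i < tips S" "t \<in> {0..1}" "x = act (addr S ! i) t" "f x = act (addr T ! i) t"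
    "x < 1 \<Longrightarrow> t < 1"
proof -
  obtain w t where w: "w \<in> set (addr S)" "t \<in> {0..1}" "x = act w t" "x < 1 \<longrightarrow> t < 1"
    using addr_cover[OF assms(2)] by blast
  then obtain i where "i < tips S" "w = addr S ! i" by (auto simp: in_set_conv_nth)
  then show ?thesis using that[of i t] tree_rep_nth[OF assms(1)] w by blast
qed

lemma tree_rep_unique:
  assumes "tree_rep m f S T" "tree_rep k g S T"
  shows "f = g"
proof (rule extensionalityI)
  show "f \<in> extensional {0..1}" "g \<in> extensional {0..1}" using assms by (auto simp: tree_rep_def)
  fix x :: real assume "x \<in> {0..1}"
  then obtain i t where "i < tips S" "t \<in> {0..1}" "x = act (addr S ! i) t" "f x = act (addr T ! i) t"
    using tree_rep_piece[OF assms(1), of x] by blast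
  then show "f x = g x" using tree_rep_nth[OF assms(2)] by simp
qed

lemma tree_rep_range:
  assumes "tree_rep m f S T" "x \<in> {0..1}"
  shows "f x \<in> {0..1}"
proof -
  obtain i t where "t \<in> {0..1}" "f x = act (addr T ! i) t"
    using tree_rep_piece[OF assms] by blast
  then show ?thesis using act_bounds by simp
qed

text \<open>Within a leaf interval \<open>f\<close> is increasing and affine, and it keeps the order of the leaf
  intervals. The smaller point is located in a leaf interval of which it is not the right end point;
  this makes the inequality strict.\<close>

lemma tree_rep_strict_mono:
  assumes "tree_rep m f S T"
  shows "strict_mono_on {0..1} f"
proof (rule strict_mono_onI)
  fix x y :: real assume xy: "x \<in> {0..1}" "y \<in> {0..1}" "x < y"
  obtain i s where x: "i < tips S" "s \<in> {0..1}" "x = act (addr S ! i) s" "f x = act (addr T ! i) s"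
      "s < 1"
    using tree_rep_piece[OF assms xy(1)] xy by (metis (no_types, opaque_lifting) atLeastAtMost_iff less_le_trans)
  obtain j t where y: "j < tips S" "t \<in> {0..1}" "y = act (addr S ! j) t" "f y = act (addr T ! j) t"
    using tree_rep_piece[OF assms xy(2)] by blast
  consider "i < j" | "i = j" | "j < i" by linarith
  then show "f x < f y"
  proof cases
    case 1
    have "f x < act (addr T ! i) 1" using x by simp
    also have "\<dots> \<le> act (addr T ! j) 0"
      using addr_sorted[of T] 1 y(1) tree_rep_tips[OF assms] by (simp add: sorted_wrt_iff_nth_less)
    also have "\<dots> \<le> f y" using y by simp
    finally show ?thesis .
  next
    case 2
    then show ?thesis using x y xy by simp
  next
    case 3
    have "y \<le> act (addr S ! j) 1" using y by simp
    also have "\<dots> \<le> act (addr S ! i) 0"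
      using addr_sorted[of S] 3 x(1) by (simp add: sorted_wrt_iff_nth_less)
    also have "\<dots> \<le> x" using x by simp
    finally show ?thesis using xy by simp
  qed
qed

lemma tree_rep_inj: "tree_rep m f S T \<Longrightarrow> inj_on f {0..1}"
  using tree_rep_strict_mono strict_mono_on_imp_inj_on by blast

lemma tree_rep_image:
  assumes "tree_rep m f S T"
  shows "f ` {0..1} = {0..1}"
proof
  show "f ` {0..1} \<subseteq> {0..1}" using tree_rep_range[OF assms] by blast
  show "{0..1} \<subseteq> f ` {0..1}"
  proof
    fix y :: real assume "y \<in> {0..1}"
    then obtain w t where w: "w \<in> set (addr T)" "t \<in> {0..1}" "y = act w t"
      using addr_cover by metis
    then obtain i where i: "i < tips T" "w = addr T ! i" by (auto simp: in_set_conv_nth)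
    then have "f (act (addr S ! i) t) = y"
      using tree_rep_nth[OF assms] tree_rep_tips[OF assms] w by simp
    then show "y \<in> f ` {0..1}" using act_bounds w by blast
  qed
qed

lemma tree_rep_continuous:
  assumes "tree_rep m f S T"
  shows "continuous_on {0..1} f"
proof -
  define I where "I w = {act w 0..act w 1}" for w
  have "continuous_on (I (addr S ! i)) f" if i: "i < tips S" for i
  proof -
    define v w where "v = addr S ! i" and "w = addr T ! i"
    have "f x = act w 0 + (x - act v 0) * 2 ^ length v / 2 ^ length w" if "x \<in> I v" for x
    proof -
      have "act v 0 \<le> x" "x \<le> act v 1" using that by (auto simp: I_def)
      then obtain t where t: "t \<in> {0..1}" "x = act v t" by (rule act_between)
      have "f x = act w t" using tree_rep_nth[OF assms i] t by (simp add: v_def w_def)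
      then show ?thesis using act_affine[of w t] act_affine[of v t] t by simp
    qed
    moreover have "continuous_on (I v) (\<lambda>x. act w 0 + (x - act v 0) * 2 ^ length v / 2 ^ length w)"
      by (intro continuous_intros) auto
    ultimately show ?thesis unfolding v_def[symmetric] by (metis (no_types, lifting) continuous_on_eq)
  qed
  then have "continuous_on (\<Union>w\<in>set (addr S). I w) f"
    by (intro continuous_on_closed_Union) (auto simp: I_def in_set_conv_nth)
  moreover have "{0..1} \<subseteq> (\<Union>w\<in>set (addr S). I w)"
  proof
    fix x :: real assume "x \<in> {0..1}"
    then obtain w t where "w \<in> set (addr S)" "t \<in> {0..1}" "x = act w t" using addr_cover by metis
    then show "x \<in> (\<Union>w\<in>set (addr S). I w)" by (auto simp: I_def intro!: bexI[of _ w])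
  qed
  ultimately show ?thesis by (rule continuous_on_subset)
qed

lemma dyadic_act_0: "dyadic (act w 0)"
proof (induction w)
  case Nil
  then show ?case by (auto simp: dyadic_def intro: exI[of _ 0])
next
  case (Cons b w)
  then obtain n :: int and k :: nat where "act w 0 = of_int n / 2 ^ k" by (auto simp: dyadic_def)
  then have "act (b # w) 0 = of_int (n + of_bool b * 2 ^ k) / 2 ^ Suc k"
    by (simp add: field_simps)
  then show ?case unfolding dyadic_def by blast
qed

lemma tree_rep_dyadic_piecewise_linear:
  assumes "tree_rep m f S T"
  shows "dyadic_piecewise_linear f"
  unfolding dyadic_piecewise_linear_def
proof (intro exI[of _ "map (\<lambda>w. act w 0) (addr S) @ [1]"] conjI allI impI)
  let ?ps = "map (\<lambda>w. act w 0) (addr S) @ [1]"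
  have nxt: "?ps ! i = act (addr S ! i) 0 \<and> ?ps ! Suc i = act (addr S ! i) 1" if "i < tips S" for i
  proof (cases "Suc i < tips S")
    case True
    then show ?thesis
      using addr_contiguous[of S] that by (auto simp: successively_conv_nth nth_append)
  next
    case False
    then have "i = tips S - 1" using that by simp
    then have "addr S ! i = last (addr S)" by (simp add: last_conv_nth)
    then show ?thesis using act_last_addr[of S] that False by (auto simp: nth_append)
  qed
  show "sorted_wrt (<) ?ps"
    by (subst sorted_wrt_iff_nth_Suc_transp) (use nxt in auto)
  show "hd ?ps = 0" using act_hd_addr[of S] by (simp add: hd_map)
  show "\<forall>p\<in>set ?ps. dyadic p"
  proof -
    have "dyadic 1" unfolding dyadic_def by (rule exI[of _ 1], rule exI[of _ 0]) simp
    then show ?thesis using dyadic_act_0 by auto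
  qed
  fix i assume "Suc i < length ?ps"
  then have i: "i < tips S" by simp
  define v w where "v = addr S ! i" and "w = addr T ! i"
  show "\<exists>(k::int) c. \<forall>t\<in>{?ps ! i..?ps ! Suc i}. f t = 2 powi k * t + c"
  proof (intro exI ballI)
    fix x assume "x \<in> {?ps ! i..?ps ! Suc i}"
    then obtain t where t: "t \<in> {0..1}" "x = act v t"
      using act_between[of v x] nxt[OF i] by (auto simp: v_def)
    have "f x = act w t" using tree_rep_nth[OF assms i] t by (simp add: v_def w_def)
    also have "\<dots> = act w 0 + (x - act v 0) * 2 ^ length v / 2 ^ length w"
      using act_affine[of w t] act_affine[of v t] t by simp
    also have "\<dots> = 2 powi (int (length v) - int (length w)) * x
        + (act w 0 - 2 powi (int (length v) - int (length w)) * act v 0)"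
      by (simp add: power_int_diff algebra_simps diff_divide_distrib)
    finally show "f x = \<dots>" .
  qed
qed auto

lemma tree_rep_carrier:
  assumes "tree_rep m f S T"
  shows "f \<in> carrier thompson_F"
proof -
  have "\<exists>g. homeomorphism {0..1} {0..1} f g"
    using homeomorphism_compact[OF compact_Icc tree_rep_continuous[OF assms]
        tree_rep_image[OF assms] tree_rep_inj[OF assms]] by metis
  then show ?thesis
    using assms tree_rep_strict_mono[OF assms] tree_rep_dyadic_piecewise_linear[OF assms]
    by (auto simp: thompson_F_def tree_rep_def)
qed

lemma tree_rep_mult:
  assumes "tree_rep m f S T" "tree_rep m g T U"
  shows "tree_rep m (f \<otimes>\<^bsub>thompson_F\<^esub> g) S U"
proof -
  have "leaf_map m (compose {0..1} g f) u w" if "leaf_map m f u v" "leaf_map m g v w" for u v w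
    using that act_bounds[of _ u] act_bounds[of _ v]
    by (auto simp: leaf_map_def compose_def intro: cong_trans)
  then have "list_all2 (leaf_map m (compose {0..1} g f)) (addr S) (addr U)"
    using assms list_all2_trans[of "leaf_map m f" "leaf_map m g"] by (auto simp: tree_rep_def)
  then show ?thesis by (simp add: tree_rep_def thompson_F_def compose_extensional)
qed

lemma tree_rep_one: "tree_rep m \<one>\<^bsub>thompson_F\<^esub> T T"
  using act_bounds by (auto simp: tree_rep_def thompson_F_def leaf_map_def list_all2_same)

text \<open>The inverse swaps the two trees. Since \<open>m_inv\<close> is a definite description, its value is
  found by showing that left inverses are unique, and for this the injectivity of \<open>f\<close> is enough.\<close>

lemma tree_rep_m_inv:
  assumes "tree_rep m f S T"
  shows "tree_rep m (inv\<^bsub>thompson_F\<^esub> f) T S"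
    and "inv\<^bsub>thompson_F\<^esub> f \<otimes>\<^bsub>thompson_F\<^esub> f = \<one>\<^bsub>thompson_F\<^esub>"
proof -
  define g where "g = restrict (inv_into {0..1} f) {0..1}"
  have "g (f x) = x" if "x \<in> {0..1}" for x
    using that tree_rep_inj[OF assms] tree_rep_range[OF assms that] by (simp add: g_def)
  then have "leaf_map m g w v" if "leaf_map m f v w" for v w
    using that act_bounds[of _ v] unfolding leaf_map_def by (metis cong_sym)
  then have "list_all2 (leaf_map m g) (addr T) (addr S)"
    using assms unfolding tree_rep_def by (simp add: list_all2_conv_all_nth)
  then have g: "tree_rep m g T S" by (simp add: tree_rep_def g_def)
  have fg: "f \<otimes>\<^bsub>thompson_F\<^esub> g = \<one>\<^bsub>thompson_F\<^esub>" "g \<otimes>\<^bsub>thompson_F\<^esub> f = \<one>\<^bsub>thompson_F\<^esub>"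
    using tree_rep_mult[OF assms g] tree_rep_mult[OF g assms] tree_rep_one tree_rep_unique by blast+
  have "h = g" if h: "h \<in> carrier thompson_F" "h \<otimes>\<^bsub>thompson_F\<^esub> f = \<one>\<^bsub>thompson_F\<^esub>" for h
  proof (rule extensionalityI)
    show "h \<in> extensional {0..1}" "g \<in> extensional {0..1}" using h by (auto simp: thompson_F_def g_def)
    fix x :: real assume x: "x \<in> {0..1}"
    have "h x \<in> {0..1}" using h(1) x by (auto simp: thompson_F_def homeomorphism_def)
    moreover have "f (h x) = x" "f (g x) = x"
      using fun_cong[OF h(2), of x] fun_cong[OF fg(2), of x] x
      by (simp_all add: thompson_F_def compose_def)
    moreover have "g x \<in> {0..1}" using tree_rep_range[OF g x] .
    ultimately show "h x = g x" using tree_rep_inj[OF assms] by (metis inj_onD)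
  qed
  then have "inv\<^bsub>thompson_F\<^esub> f = g"
    unfolding m_inv_def using fg tree_rep_carrier[OF g] by (intro the_equality) blast+
  then show "tree_rep m (inv\<^bsub>thompson_F\<^esub> f) T S"
    "inv\<^bsub>thompson_F\<^esub> f \<otimes>\<^bsub>thompson_F\<^esub> f = \<one>\<^bsub>thompson_F\<^esub>"
    using g fg by simp_all
qed

lemma tree_rep_F_add:
  assumes "tree_rep m f S S'" "tree_rep m g T T'"
  shows "tree_rep m (F_add f g) (Fork S T) (Fork S' T')"
proof -
  have l: "F_add f g (act (False # v) t) = act (False # v') t"
    if "t \<in> {0..1}" "f (act v t) = act v' t" for t v v'
    using act_bounds[OF that(1), of v] that by (auto simp: F_add_def)
  have r: "F_add f g (act (True # w) t) = act (True # w') t"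
    if "t \<in> {0..1}" "g (act w t) = act w' t" for t w w'
  proof (cases "act w t = 0")
    case True
    \<comment> \<open>At the midpoint the two halves agree because elements of F fix the end points.\<close>
    have "f 1 = 1"
    proof -
      obtain z where z: "z \<in> {0..1}" "f z = 1"
        using tree_rep_image[OF assms(1)] by (metis atLeastAtMost_iff imageE order_refl zero_le_one)
      then show ?thesis
        using strict_mono_onD[OF tree_rep_strict_mono[OF assms(1)], of z 1]
          tree_rep_range[OF assms(1), of 1] by (cases "z = 1") auto
    qed
    moreover have "act w' t = 0"
    proof -
      obtain z where z: "z \<in> {0..1}" "g z = 0"
        using tree_rep_image[OF assms(2)] by (metis atLeastAtMost_iff imageE order_refl zero_le_one)
      then have "g 0 = 0"
        using strict_mono_onD[OF tree_rep_strict_mono[OF assms(2)], of 0 z]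
          tree_rep_range[OF assms(2), of 0] by (cases "z = 0") auto
      then show ?thesis using that True by simp
    qed
    ultimately show ?thesis using True by (simp add: F_add_def)
  next
    case False
    then show ?thesis
      using act_bounds[OF that(1), of w] that by (auto simp: F_add_def field_simps)
  qed
  have "list_all2 (leaf_map m (F_add f g)) (addr (Fork S T)) (addr (Fork S' T'))"
    unfolding addr.simps
  proof (rule list_all2_appendI; unfold list_all2_map1 list_all2_map2)
    show "list_all2 (\<lambda>v w. leaf_map m (F_add f g) (False # v) (False # w)) (addr S) (addr S')"
      using assms(1) l unfolding tree_rep_def leaf_map_def
      by (auto elim!: list_all2_mono simp del: act.simps)
    have "[Suc a = Suc b] (mod m)" if "[a = b] (mod m)" for a b
      using cong_add[OF cong_refl that, of 1] by simp
    then show "list_all2 (\<lambda>v w. leaf_map m (F_add f g) (True # v) (True # w)) (addr T) (addr T')"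
      using assms(2) r unfolding tree_rep_def leaf_map_def
      by (auto elim!: list_all2_mono simp del: act.simps)
  qed
  then show ?thesis by (simp add: tree_rep_def F_add_def)
qed

section \<open>Common refinements\<close>

fun subst :: "btree \<Rightarrow> btree list \<Rightarrow> btree" where
  "subst Tip Us = hd Us"
| "subst (Fork l r) Us = Fork (subst l (take (tips l) Us)) (subst r (drop (tips l) Us))"

lemma subst_replicate_Tip [simp]: "subst T (replicate (tips T) Tip) = T"
  by (induction T) (auto simp: hd_replicate)

lemma addr_subst:
  "length Us = tips T \<Longrightarrow>
    addr (subst T Us) = concat (map2 (\<lambda>w U. map ((@) w) (addr U)) (addr T) Us)"
proof (induction T arbitrary: Us)
  case Tip
  then obtain U where "Us = [U]" by (auto simp: length_Suc_conv)
  then show ?case by (simp add: map_idI)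
next
  case (Fork l r)
  have "zip (addr (Fork l r)) Us = zip (map ((#) False) (addr l)) (take (tips l) Us)
      @ zip (map ((#) True) (addr r)) (drop (tips l) Us)"
    by (simp add: zip_append1)
  moreover have "(@) (b # v) = (\<lambda>x. b # v @ x)" for b :: bool and v by auto
  ultimately show ?case
    using Fork by (simp add: zip_map1 map_concat comp_def case_prod_beta)
qed

lemma list_all2_concat_prefix:
  assumes "length vs = length ws" "length ws = length Us"
  shows "list_all2 R (concat (map2 (\<lambda>v U. map ((@) v) (addr U)) vs Us))
        (concat (map2 (\<lambda>w U. map ((@) w) (addr U)) ws Us))
      \<longleftrightarrow> list_all2 (\<lambda>(v, U) w. \<forall>u\<in>set (addr U). R (v @ u) (w @ u)) (zip vs Us) ws"
  using assms
  by (induction vs ws Us rule: list_induct3)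
    (auto simp: list_all2_append list_all2_map1 list_all2_map2 list_all2_same)

text \<open>The leaf intervals of \<open>U\<close> cover the unit interval, so an affine condition on a leaf interval
  can be tested on its parts. The appended turns are the same on both sides and cancel in the
  congruence.\<close>

lemma leaf_map_append_iff:
  "leaf_map m f v w \<longleftrightarrow> (\<forall>u\<in>set (addr U). leaf_map m f (v @ u) (w @ u))"
proof
  assume "leaf_map m f v w"
  then show "\<forall>u\<in>set (addr U). leaf_map m f (v @ u) (w @ u)"
    using act_bounds by (auto simp: leaf_map_def act_append intro: cong_add)
next
  assume *: "\<forall>u\<in>set (addr U). leaf_map m f (v @ u) (w @ u)"
  have "f (act v t) = act w t" if "t \<in> {0..1}" for t
  proof -
    obtain u s where "u \<in> set (addr U)" "s \<in> {0..1}" "t = act u s" using addr_cover[OF \<open>t \<in> {0..1}\<close>, of U] by blast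
    then show ?thesis using * by (auto simp: leaf_map_def act_append)
  qed
  moreover have "[ones v = ones w] (mod m)"
    using bspec[OF *, of "hd (addr U)"] by (simp add: leaf_map_def cong_add_rcancel_nat)
  ultimately show "leaf_map m f v w" by (simp add: leaf_map_def)
qed

text \<open>Refining both trees in the same way changes neither the homeomorphism nor the congruence of
  labels. Read from left to right, this allows the removal of common carets.\<close>

lemma tree_rep_subst_iff:
  assumes "length Us = tips S" "tips S = tips T"
  shows "tree_rep m f (subst S Us) (subst T Us) \<longleftrightarrow> tree_rep m f S T"
proof -
  have "list_all2 (leaf_map m f) (addr (subst S Us)) (addr (subst T Us))
      \<longleftrightarrow> list_all2 (\<lambda>(v, U) w. leaf_map m f v w) (zip (addr S) Us) (addr T)"
    using assms leaf_map_append_iff[of m f]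
    by (simp add: addr_subst list_all2_concat_prefix cong: list.rel_cong)
  also have "\<dots> \<longleftrightarrow> list_all2 (leaf_map m f) (addr S) (addr T)"
    using assms by (auto simp: list_all2_conv_all_nth)
  finally show ?thesis by (simp add: tree_rep_def)
qed

lemma common_refinement:
  "\<exists>Us Vs. length Us = tips S \<and> length Vs = tips T \<and> subst S Us = subst T Vs"
proof (induction S arbitrary: T)
  case Tip
  then show ?case
    by (intro exI[of _ "[T]"] exI[of _ "replicate (tips T) Tip"]) auto
next
  case (Fork l r)
  note S = Fork
  show ?case
  proof (cases T)
    case Tip
    then show ?thesis
      using subst_replicate_Tip[of "Fork l r"]
      by (intro exI[of _ "replicate (tips (Fork l r)) Tip"] exI[of _ "[Fork l r]"])
        (simp del: subst_replicate_Tip subst.simps(2))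
  next
    case T: (Fork l' r')
    obtain Us Vs where l: "length Us = tips l" "length Vs = tips l'" "subst l Us = subst l' Vs"
      using S(1) by blast
    obtain Us' Vs' where r: "length Us' = tips r" "length Vs' = tips r'" "subst r Us' = subst r' Vs'"
      using S(2) by blast
    show ?thesis
      using T l r by (intro exI[of _ "Us @ Us'"] exI[of _ "Vs @ Vs'"]) auto
  qed
qed

text \<open>Two tree pairs can be composed after refining the inner trees to a common tree.\<close>

lemma tree_group_composable:
  assumes "f \<in> tree_group m" "g \<in> tree_group m"
  shows "\<exists>S T U. tree_rep m f S T \<and> tree_rep m g T U"
proof -
  obtain S T T' U where f: "tree_rep m f S T" and g: "tree_rep m g T' U"
    using assms by (auto simp: tree_group_def)
  obtain Us Vs where r: "length Us = tips T" "length Vs = tips T'" "subst T Us = subst T' Vs"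
    using common_refinement by blast
  have "tree_rep m f (subst S Us) (subst T Us)" "tree_rep m g (subst T' Vs) (subst U Vs)"
    using f g r(1,2) tree_rep_tips[OF f] tree_rep_tips[OF g] by (simp_all add: tree_rep_subst_iff)
  then show ?thesis using r(3) by metis
qed

lemma tree_group_closed:
  "f \<in> tree_group m \<Longrightarrow> g \<in> tree_group m \<Longrightarrow> f \<otimes>\<^bsub>thompson_F\<^esub> g \<in> tree_group m"
  using tree_group_composable tree_rep_mult by (fastforce simp: tree_group_def)

lemma tree_group_one: "\<one>\<^bsub>thompson_F\<^esub> \<in> tree_group m"
  using tree_rep_one by (auto simp: tree_group_def)

lemma tree_group_inv: "f \<in> tree_group m \<Longrightarrow> inv\<^bsub>thompson_F\<^esub> f \<in> tree_group m"
  using tree_rep_m_inv(1) by (fastforce simp: tree_group_def)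

lemma tree_group_F_add: "f \<in> tree_group m \<Longrightarrow> g \<in> tree_group m \<Longrightarrow> F_add f g \<in> tree_group m"
  using tree_rep_F_add by (fastforce simp: tree_group_def)

lemma tree_group_subset: "tree_group m \<subseteq> carrier thompson_F"
  using tree_rep_carrier by (auto simp: tree_group_def)

lemma subgroup_tree_group: "subgroup (tree_group m) thompson_F"
  by (rule subgroup.intro)
    (use tree_group_subset tree_group_closed tree_group_one tree_group_inv in auto)

section \<open>The generators\<close>

text \<open>Evaluating the conjugates that define the generators needs the group laws.\<close>

lemma group_tree_group: "group (thompson_F\<lparr>carrier := tree_group m\<rparr>)"
proof (rule groupI)
  let ?G = "thompson_F\<lparr>carrier := tree_group m\<rparr>"
  fix x assume "x \<in> carrier ?G"
  then obtain S T where x: "tree_rep m x S T" by (auto simp: tree_group_def)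
  show "\<one>\<^bsub>?G\<^esub> \<otimes>\<^bsub>?G\<^esub> x = x"
    using tree_rep_unique[OF tree_rep_mult[OF tree_rep_one x] x] by simp
  show "\<exists>y\<in>carrier ?G. y \<otimes>\<^bsub>?G\<^esub> x = \<one>\<^bsub>?G\<^esub>"
    using tree_rep_m_inv[OF x] by (auto simp: tree_group_def)
  fix y z
  show "x \<otimes>\<^bsub>?G\<^esub> y \<otimes>\<^bsub>?G\<^esub> z = x \<otimes>\<^bsub>?G\<^esub> (y \<otimes>\<^bsub>?G\<^esub> z)"
    using tree_rep_range[OF x] by (auto simp: thompson_F_def compose_def restrict_def)
qed (auto simp: tree_group_closed tree_group_one)

lemma tree_group_m_inv_eq:
  assumes "f \<in> tree_group m"
  shows "inv\<^bsub>thompson_F\<lparr>carrier := tree_group m\<rparr>\<^esub> f = inv\<^bsub>thompson_F\<^esub> f"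
proof -
  let ?G = "thompson_F\<lparr>carrier := tree_group m\<rparr>"
  interpret group ?G by (rule group_tree_group)
  show ?thesis
    using assms tree_group_inv[OF assms] tree_rep_m_inv(2)
    by (intro inv_equality) (auto simp: tree_group_def)
qed

lemma nat_pow_carrier_update: "x [^]\<^bsub>G\<lparr>carrier := A\<rparr>\<^esub> (k::nat) = x [^]\<^bsub>G\<^esub> k"
  by (simp add: nat_pow_def)

lemma tree_rep_x0: "tree_rep 1 F_x0 (Fork (Fork Tip Tip) Tip) (Fork Tip (Fork Tip Tip))"
  by (auto simp: tree_rep_def leaf_map_def F_x0_def field_simps)

lemma x0_tree_group: "F_x0 \<in> tree_group 1"
  using tree_rep_x0 unfolding tree_group_def by blast

lemma F_x1_eq: "F_x1 = F_add \<one>\<^bsub>thompson_F\<^esub> F_x0"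
  by (auto simp: fun_eq_iff F_x1_def F_add_def F_x0_def thompson_F_def field_simps)

text \<open>Conjugation by \<open>x\<^sub>0\<close> turns \<open>1 \<oplus> g\<close> into \<open>1 \<oplus> (1 \<oplus> g)\<close>, because \<open>x\<^sub>0\<close> maps the interval from
  \<open>1/2\<close> to 1 affinely onto the interval from \<open>3/4\<close> to 1.\<close>

lemma x0_conjugates:
  assumes "g \<in> tree_group 1"
  defines "y \<equiv> F_add \<one>\<^bsub>thompson_F\<^esub> g"
  shows "y \<otimes>\<^bsub>thompson_F\<^esub> F_x0 = F_x0 \<otimes>\<^bsub>thompson_F\<^esub> F_add \<one>\<^bsub>thompson_F\<^esub> y"
proof
  fix t
  have "g x \<in> {0..1}" if "x \<in> {0..1}" for x
    using assms(1) that tree_rep_range by (auto simp: tree_group_def)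
  then have "0 \<le> g (2 * t - 1)" "g (2 * t - 1) \<le> 1" if "1/2 \<le> t" "t \<le> 1"
    using that by auto
  then show "(y \<otimes>\<^bsub>thompson_F\<^esub> F_x0) t = (F_x0 \<otimes>\<^bsub>thompson_F\<^esub> F_add \<one>\<^bsub>thompson_F\<^esub> y) t"
    unfolding y_def by (auto simp: thompson_F_def compose_def F_add_def F_x0_def field_simps)
qed

text \<open>Each further generator is the previous one acting on the right half of the interval.\<close>

lemma F_gen_eq: "F_gen i = (F_add \<one>\<^bsub>thompson_F\<^esub> ^^ i) F_x0"
proof (cases i)
  case (Suc i)
  let ?F = thompson_F and ?G = "thompson_F\<lparr>carrier := tree_group 1\<rparr>"
  interpret G: group ?G by (rule group_tree_group)
  define y where "y j = (F_add \<one>\<^bsub>?F\<^esub> ^^ j) F_x0" for j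
  define p where "p j = F_x0 [^]\<^bsub>?F\<^esub> (j::nat)" for j
  note x0 = x0_tree_group
  have y: "y j \<in> tree_group 1" for j
    unfolding y_def using x0 by (induction j) (simp_all add: tree_group_F_add tree_group_one)
  have p: "p j \<in> tree_group 1" for j
    using G.nat_pow_closed[of F_x0 j] x0 by (simp add: p_def nat_pow_carrier_update)
  have pSuc: "p (Suc j) = p j \<otimes>\<^bsub>?F\<^esub> F_x0" for j by (simp add: p_def)
  have x1: "F_x1 = y (Suc 0)" "F_x1 \<in> tree_group 1"
    using y[of "Suc 0"] by (simp_all add: y_def F_x1_eq)
  have "F_x1 \<otimes>\<^bsub>?F\<^esub> p j = p j \<otimes>\<^bsub>?F\<^esub> y (Suc j)" for j
  proof (induction j)
    case 0
    show ?case using G.l_one[of F_x1] G.r_one[of F_x1] x1 by (simp add: p_def)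
  next
    case (Suc j)
    have "F_x1 \<otimes>\<^bsub>?F\<^esub> p (Suc j) = (F_x1 \<otimes>\<^bsub>?F\<^esub> p j) \<otimes>\<^bsub>?F\<^esub> F_x0"
      using G.m_assoc[of F_x1 "p j" F_x0] p x0 x1 by (simp add: pSuc)
    also have "\<dots> = p j \<otimes>\<^bsub>?F\<^esub> (y (Suc j) \<otimes>\<^bsub>?F\<^esub> F_x0)"
      using G.m_assoc[of "p j" "y (Suc j)" F_x0] p x0 y by (simp add: Suc)
    also have "y (Suc j) \<otimes>\<^bsub>?F\<^esub> F_x0 = F_x0 \<otimes>\<^bsub>?F\<^esub> y (Suc (Suc j))"
      using x0_conjugates[OF y[of j]] by (simp add: y_def)
    also have "p j \<otimes>\<^bsub>?F\<^esub> \<dots> = p (Suc j) \<otimes>\<^bsub>?F\<^esub> y (Suc (Suc j))"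
      using G.m_assoc[of "p j" F_x0 "y (Suc (Suc j))"] p x0 y by (simp add: pSuc)
    finally show ?case .
  qed
  moreover have "F_x0 [^]\<^bsub>?F\<^esub> (- int i) = inv\<^bsub>?F\<^esub> (p i)" "F_x0 [^]\<^bsub>?F\<^esub> int i = p i"
    using G.inv_one tree_group_m_inv_eq[OF tree_group_one[of 1]]
    by (auto simp: int_pow_def2 p_def)
  moreover have "inv\<^bsub>?F\<^esub> (p i) \<otimes>\<^bsub>?F\<^esub> F_x1 \<otimes>\<^bsub>?F\<^esub> p i = inv\<^bsub>?F\<^esub> (p i) \<otimes>\<^bsub>?F\<^esub> (F_x1 \<otimes>\<^bsub>?F\<^esub> p i)"
    using G.m_assoc[of "inv\<^bsub>?F\<^esub> (p i)" F_x1 "p i"] p tree_group_inv[OF p] x1(2)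
    by simp
  moreover have "inv\<^bsub>?F\<^esub> (p i) \<otimes>\<^bsub>?F\<^esub> (p i \<otimes>\<^bsub>?F\<^esub> y (Suc i)) = y (Suc i)"
    using G.m_assoc[of "inv\<^bsub>?F\<^esub> (p i)" "p i" "y (Suc i)"] p tree_group_inv[OF p] y
      G.l_inv[of "p i"] G.l_one[of "y (Suc i)"]
    by (simp add: tree_group_m_inv_eq)
  ultimately show ?thesis using Suc by (simp add: y_def)
qed simp

lemma F_add_one_mult:
  assumes "f \<in> tree_group m" "g \<in> tree_group m"
  shows "F_add \<one>\<^bsub>thompson_F\<^esub> (f \<otimes>\<^bsub>thompson_F\<^esub> g)
      = F_add \<one>\<^bsub>thompson_F\<^esub> f \<otimes>\<^bsub>thompson_F\<^esub> F_add \<one>\<^bsub>thompson_F\<^esub> g"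
proof -
  obtain S T U where "tree_rep m f S T" "tree_rep m g T U" using tree_group_composable[OF assms] by blast
  then show ?thesis
    using tree_rep_F_add tree_rep_one tree_rep_mult tree_rep_unique by meson
qed

definition gen_product :: "nat \<Rightarrow> real \<Rightarrow> real" where
  "gen_product k = foldr (\<otimes>\<^bsub>thompson_F\<^esub>) (map F_gen [0..<k]) \<one>\<^bsub>thompson_F\<^esub>"

lemma gen_product_Suc:
  "gen_product (Suc k) = F_x0 \<otimes>\<^bsub>thompson_F\<^esub> F_add \<one>\<^bsub>thompson_F\<^esub> (gen_product k)"
proof -
  let ?mult = "\<lambda>fs. foldr (\<otimes>\<^bsub>thompson_F\<^esub>) fs \<one>\<^bsub>thompson_F\<^esub>"
  have shift: "?mult (map (F_add \<one>\<^bsub>thompson_F\<^esub>) fs) = F_add \<one>\<^bsub>thompson_F\<^esub> (?mult fs) \<and>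
      ?mult fs \<in> tree_group 1" if "set fs \<subseteq> tree_group 1" for fs
    using that
  proof (induction fs)
    case Nil
    have "F_add \<one>\<^bsub>thompson_F\<^esub> \<one>\<^bsub>thompson_F\<^esub> = \<one>\<^bsub>thompson_F\<^esub>"
      using tree_rep_F_add[OF tree_rep_one tree_rep_one] tree_rep_one by (rule tree_rep_unique)
    then show ?case by (simp add: tree_group_one)
  qed (auto simp: F_add_one_mult tree_group_closed)
  have gen: "F_gen i \<in> tree_group 1" for i
    unfolding F_gen_eq using x0_tree_group
    by (induction i) (auto simp: tree_group_F_add tree_group_one)
  have "map F_gen [0..<Suc k] = F_x0 # map (F_add \<one>\<^bsub>thompson_F\<^esub>) (map F_gen [0..<k])"
    by (simp add: upt_conv_Cons map_Suc_upt[symmetric] F_gen_eq del: F_gen.simps upt_Suc)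
  moreover have "set (map F_gen [0..<k]) \<subseteq> tree_group 1" using gen by auto
  ultimately show ?thesis
    using shift[of "map F_gen [0..<k]"] unfolding gen_product_def by (simp del: map_map upt_Suc)
qed

text \<open>Since \<open>x\<^bsub>i+1\<^esub> = 1 \<oplus> x\<^sub>i\<close>, the product of \<open>k + 1\<close> generators is \<open>x\<^sub>0\<close> followed by
  \<open>1 \<oplus> x\<^sub>0 \<dots> x\<^bsub>k-1\<^esub>\<close>. The first factor moves the first leaf of the comb to the root, the second
  one rotates the remaining tree. The induction starts with the empty product.\<close>

lemma tree_rep_gen_product:
  "tree_rep 1 (gen_product k)
    (Fork (comb (replicate k Tip) Tip) Tip) (comb (replicate k Tip) (Fork Tip Tip))"
proof (induction k)
  case 0
  then show ?case using tree_rep_one by (simp add: gen_product_def)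
next
  case (Suc k)
  let ?c = "comb (replicate k Tip) Tip"
  have "tree_rep 1 F_x0 (Fork (Fork Tip ?c) Tip) (Fork Tip (Fork ?c Tip))"
    using tree_rep_subst_iff[of "[Tip, ?c, Tip]" "Fork (Fork Tip Tip) Tip" "Fork Tip (Fork Tip Tip)" 1 F_x0]
      tree_rep_x0 by simp
  from tree_rep_mult[OF this tree_rep_F_add[OF tree_rep_one Suc]] show ?case
    unfolding gen_product_Suc by simp
qed

lemma subst_comb:
  "subst (comb (replicate (length as) Tip) T) (as @ Us) = comb as (subst T Us)"
  by (induction as) auto

lemma tips_comb_replicate: "tips (comb (replicate k Tip) T) = k + tips T"
  by (induction k) auto

text \<open>The product of the first \<open>m\<close> generators realizes every instance of the law of
  \<open>m\<close>-associativity, by substitution into the instance whose variables are leaves.\<close>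

lemma tree_rep_shift:
  assumes "length as = m"
  shows "tree_rep m (gen_product m) (Fork (comb as S) T) (comb as (Fork S T))"
proof -
  let ?P = "Fork (comb (replicate m Tip) Tip) Tip" and ?Q = "comb (replicate m Tip) (Fork Tip Tip)"
  have "tree_rep m (gen_product m) ?P ?Q"
    using tree_rep_gen_product assoc_labels[OF assoc.shift[of "replicate m Tip" m Tip Tip]]
    by (subst tree_rep_iff_labels) simp
  then have "tree_rep m (gen_product m) (subst ?P (as @ [S, T])) (subst ?Q (as @ [S, T]))"
    using assms by (subst tree_rep_subst_iff) (auto simp: tips_comb_replicate)
  moreover have "subst ?P (as @ [S, T]) = Fork (comb as S) T"
    using assms subst_comb[of as Tip "[S]"] by (simp add: tips_comb_replicate)
  moreover have "subst ?Q (as @ [S, T]) = comb as (Fork S T)"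
    using assms subst_comb[of as "Fork Tip Tip" "[S, T]"] by simp
  ultimately show ?thesis by simp
qed

lemma assoc_in_subgroup:
  assumes "assoc m S T" "subgroup H thompson_F" "gen_product m \<in> H"
    and "\<And>a b. a \<in> H \<Longrightarrow> b \<in> H \<Longrightarrow> F_add a b \<in> H"
  shows "\<exists>h\<in>H. tree_rep m h S T"
  using assms(1)
proof induction
  case (refl T)
  show ?case using tree_rep_one subgroup.one_closed[OF assms(2)] by blast
next
  case (sym S T)
  then show ?case using tree_rep_m_inv(1) subgroup.m_inv_closed[OF assms(2)] by blast
next
  case (trans S T U)
  then show ?case using tree_rep_mult subgroup.m_closed[OF assms(2)] by blast
next
  case (fork S S' T T')
  then show ?case using tree_rep_F_add assms(4) by blast
next
  case (shift as S T)
  then show ?case using tree_rep_shift assms(3) by blast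
qed

theorem H_group_eq_tree_group:
  assumes "n \<ge> 2"
  shows "H_group n = tree_group (n - 1)"
proof
  have gen: "F_gen_prod (n - 2) = gen_product (n - 1)"
  proof -
    have "Suc (n - 2) = n - 1" using assms by simp
    then show ?thesis unfolding F_gen_prod_def gen_product_def by (simp only:)
  qed
  have "gen_product (n - 1) \<in> tree_group (n - 1)"
    using tree_rep_shift[of "replicate (n - 1) Tip" "n - 1"] by (auto simp: tree_group_def)
  then show "H_group n \<subseteq> tree_group (n - 1)"
    using subgroup_tree_group tree_group_F_add by (auto simp: H_group_def gen)
  show "tree_group (n - 1) \<subseteq> H_group n"
  proof
    fix f assume "f \<in> tree_group (n - 1)"
    then obtain S T where f: "tree_rep (n - 1) f S T" by (auto simp: tree_group_def)
    then have "cong_lists (n - 1) (labels S) (labels T)" using tree_rep_iff_labels by blast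
    then have ST: "assoc (n - 1) S T" using assms by (simp add: assoc_iff_labels)
    show "f \<in> H_group n"
      unfolding H_group_def
    proof (intro InterI, clarify)
      fix H assume H: "subgroup H thompson_F" "F_gen_prod (n - 2) \<in> H"
        "\<forall>a\<in>H. \<forall>b\<in>H. F_add a b \<in> H"
      then obtain h where "h \<in> H" "tree_rep (n - 1) h S T"
        using assoc_in_subgroup[OF ST, of H] by (auto simp: gen)
      then show "f \<in> H" using tree_rep_unique[OF f] by blast
    qed
  qed
qed

section \<open>Positive diagrams are forests\<close>

text \<open>A tree of cells \<open>\<pi>\<close>, recorded by its edges: a fork is a cell whose top edge is the label of
  the fork and whose bottom edges are the labels of its two children.\<close>

datatype 'e ltree = LTip 'e | LFork 'e "'e ltree" "'e ltree"

fun root_edge :: "'e ltree \<Rightarrow> 'e" where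
  "root_edge (LTip e) = e"
| "root_edge (LFork e l r) = e"

fun leaves :: "'e ltree \<Rightarrow> 'e list" where
  "leaves (LTip e) = [e]"
| "leaves (LFork e l r) = leaves l @ leaves r"

fun shape :: "'e ltree \<Rightarrow> btree" where
  "shape (LTip e) = Tip"
| "shape (LFork e l r) = Fork (shape l) (shape r)"

fun cells :: "'e ltree \<Rightarrow> ('e list \<times> 'e list) set" where
  "cells (LTip e) = {}"
| "cells (LFork e l r) = insert ([e], [root_edge l, root_edge r]) (cells l \<union> cells r)"

fun aligned :: "('e \<Rightarrow> 'v) \<Rightarrow> ('e \<Rightarrow> 'v) \<Rightarrow> 'e ltree \<Rightarrow> bool" where
  "aligned t h (LTip e) = True"
| "aligned t h (LFork e l r) = (t e = t (root_edge l) \<and> h (root_edge l) = t (root_edge r) \<and> h e = h (root_edge r)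
    \<and> aligned t h l \<and> aligned t h r)"

definition chained :: "('e \<Rightarrow> 'v) \<Rightarrow> ('e \<Rightarrow> 'v) \<Rightarrow> 'e list \<Rightarrow> bool" where
  "chained t h es = successively (\<lambda>d e. h d = t e) es"

definition edge_verts :: "('e \<Rightarrow> 'v) \<Rightarrow> ('e \<Rightarrow> 'v) \<Rightarrow> 'e list \<Rightarrow> 'v list" where
  "edge_verts t h es = t (hd es) # map h es"

lemma leaves_not_Nil [simp]: "leaves L \<noteq> []"
  by (induction L) auto

lemma length_leaves [simp]: "length (leaves L) = tips (shape L)"
  by (induction L) auto

lemma root_in_set [simp]: "root_edge L \<in> set_ltree L"
  by (cases L) auto

lemma leaves_subset: "set (leaves L) \<subseteq> set_ltree L"
  by (induction L) auto

lemma aligned_leaves: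
  "aligned t h L \<Longrightarrow> t (hd (leaves L)) = t (root_edge L) \<and> h (last (leaves L)) = h (root_edge L)
    \<and> chained t h (leaves L)"
  by (induction L) (auto simp: chained_def successively_append_iff)

lemma aligned_forest:
  assumes "Ls \<noteq> []" "chained t h (map root_edge Ls)" "\<forall>L\<in>set Ls. aligned t h L"
  shows "t (hd (concat (map leaves Ls))) = t (hd (map root_edge Ls)) \<and>
    h (last (concat (map leaves Ls))) = h (last (map root_edge Ls)) \<and>
    chained t h (concat (map leaves Ls))"
  using assms
proof (induction Ls rule: list_nonempty_induct)
  case (single L)
  then show ?case using aligned_leaves by auto
next
  case (cons L Ls)
  then have "chained t h (map root_edge Ls)" "h (root_edge L) = t (hd (map root_edge Ls))"
    by (auto simp: chained_def successively_Cons)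
  moreover have "concat (map leaves Ls) \<noteq> []" using cons.hyps by (cases Ls) auto
  ultimately show ?case
    using cons aligned_leaves[of t h L] by (auto simp: chained_def successively_append_iff)
qed

lemma awalk_verts_eq_edge_verts:
  assumes "es \<noteq> []" "chained (tail G) (head G) es"
  shows "pre_digraph.awalk_verts G u es = edge_verts (tail G) (head G) es"
  using assms
proof (induction es arbitrary: u rule: list_nonempty_induct)
  case (cons e es)
  then show ?case
    by (cases es) (auto simp: chained_def edge_verts_def pre_digraph.awalk_verts.simps)
qed (auto simp: edge_verts_def pre_digraph.awalk_verts.simps)

text \<open>A diagram that consists of the cells of a row of trees. All of its vertices lie
  on the bottom path and are distinct.\<close>

definition forest_diag :: "('v, 'e) diag \<Rightarrow> 'e ltree list \<Rightarrow> bool" where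
  "forest_diag D Ls \<longleftrightarrow> Ls \<noteq> [] \<and> dtop D = map root_edge Ls \<and> dbot D = concat (map leaves Ls) \<and>
    dcells D = \<Union> (cells ` set Ls) \<and> arcs (dgraph D) = \<Union> (set_ltree ` set Ls) \<and>
    (\<forall>L\<in>set Ls. aligned (tail (dgraph D)) (head (dgraph D)) L) \<and>
    chained (tail (dgraph D)) (head (dgraph D)) (dtop D) \<and>
    distinct (edge_verts (tail (dgraph D)) (head (dgraph D)) (dbot D)) \<and>
    verts (dgraph D) = set (edge_verts (tail (dgraph D)) (head (dgraph D)) (dbot D))"

lemma forest_diagD:
  assumes "forest_diag D Ls"
  shows "Ls \<noteq> []" "dtop D = map root_edge Ls" "dbot D = concat (map leaves Ls)"
    "dcells D = \<Union> (cells ` set Ls)" "arcs (dgraph D) = \<Union> (set_ltree ` set Ls)"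
    "\<forall>L\<in>set Ls. aligned (tail (dgraph D)) (head (dgraph D)) L"
    "chained (tail (dgraph D)) (head (dgraph D)) (dtop D)"
    "distinct (edge_verts (tail (dgraph D)) (head (dgraph D)) (dbot D))"
    "verts (dgraph D) = set (edge_verts (tail (dgraph D)) (head (dgraph D)) (dbot D))"
  using assms unfolding forest_diag_def by blast+

lemma forest_diag_ends:
  assumes "forest_diag D Ls"
  shows "tail (dgraph D) (hd (dbot D)) = tail (dgraph D) (hd (dtop D))"
    "head (dgraph D) (last (dbot D)) = head (dgraph D) (last (dtop D))"
    "chained (tail (dgraph D)) (head (dgraph D)) (dbot D)" "dbot D \<noteq> []" "dtop D \<noteq> []"
  using assms aligned_forest[of Ls "tail (dgraph D)" "head (dgraph D)"]
  by (auto simp: forest_diag_def neq_Nil_conv)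

lemma edge_verts_append:
  assumes "es \<noteq> []" "fs \<noteq> []" "h (last es) = t (hd fs)"
  shows "edge_verts t h (es @ fs) = edge_verts t h es @ map h fs"
    "set (edge_verts t h (es @ fs)) = set (edge_verts t h es) \<union> set (edge_verts t h fs)"
proof -
  show "edge_verts t h (es @ fs) = edge_verts t h es @ map h fs"
    using assms by (simp add: edge_verts_def)
  moreover have "h (last es) \<in> h ` set es" using assms(1) by (intro imageI last_in_set)
  ultimately show "set (edge_verts t h (es @ fs)) = set (edge_verts t h es) \<union> set (edge_verts t h fs)"
    using assms by (auto simp: edge_verts_def)
qed

lemma forest_diag_dsum:
  assumes D1: "forest_diag D1 Ls1" and D2: "forest_diag D2 Ls2"
    and comp: "compatible (dgraph D1) (dgraph D2)" and ends: "dterm D1 = dinit D2"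
    and verts: "verts (dgraph D1) \<inter> verts (dgraph D2) = {dterm D1}"
  shows "forest_diag (dsum D1 D2) (Ls1 @ Ls2)"
proof -
  let ?t = "tail (dgraph D1)" and ?h = "head (dgraph D1)"
  have th: "tail (dgraph D2) = ?t" "head (dgraph D2) = ?h"
    using comp by (auto simp: compatible_def)
  note e1 = forest_diag_ends[OF D1] and e2 = forest_diag_ends[OF D2]
  have glue: "?h (last (dbot D1)) = ?t (hd (dbot D2))"
    using ends e1 e2 th by (simp add: dterm_def dinit_def)
  have topglue: "?h (last (dtop D1)) = ?t (hd (dtop D2))"
    using ends th by (simp add: dterm_def dinit_def)
  note ev = edge_verts_append[OF e1(4) e2(4), of ?h ?t, OF glue]
  have d: "distinct (edge_verts ?t ?h (dbot D1))" "distinct (edge_verts ?t ?h (dbot D2))"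
    and v: "verts (dgraph D1) = set (edge_verts ?t ?h (dbot D1))"
      "verts (dgraph D2) = set (edge_verts ?t ?h (dbot D2))"
    using forest_diagD(8,9)[OF D1] forest_diagD(8,9)[OF D2] th by simp_all
  define C where "C = ?h ` set (dbot D2)"
  have "?t (hd (dbot D2)) \<notin> C" using d(2) by (simp add: edge_verts_def C_def)
  then have "dterm D1 \<notin> C" using glue e1 by (simp add: dterm_def)
  moreover have "C \<subseteq> verts (dgraph D2)" unfolding v C_def by (auto simp: edge_verts_def)
  moreover have "z = dterm D1" if "z \<in> verts (dgraph D1)" "z \<in> verts (dgraph D2)" for z
    using verts that by (metis IntI singletonD)
  ultimately have "verts (dgraph D1) \<inter> C = {}" by blast
  then have "distinct (edge_verts ?t ?h (dbot D1 @ dbot D2))"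
    using d unfolding ev(1) v C_def by (simp add: edge_verts_def)
  moreover have "chained ?t ?h (dtop D1 @ dtop D2)"
    using forest_diagD(7)[OF D1] forest_diagD(7)[OF D2] th topglue e1(5) e2(5)
    by (simp add: chained_def successively_append_iff)
  ultimately show ?thesis
    using forest_diagD[OF D1] forest_diagD[OF D2] th ev(2)
    unfolding forest_diag_def dsum_def Digraph_Component.union_def by (simp add: ball_Un)
qed

definition grafted ::
    "('e \<Rightarrow> 'v) \<Rightarrow> ('e \<Rightarrow> 'v) \<Rightarrow> 'e ltree list \<Rightarrow> 'e ltree list \<Rightarrow> 'e ltree list \<Rightarrow> bool" where
  "grafted t h Ls Ms Ns \<longleftrightarrow> map root_edge Ns = map root_edge Ls \<and>
    concat (map leaves Ns) = concat (map leaves Ms) \<and>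
    \<Union> (cells ` set Ns) = \<Union> (cells ` set Ls) \<union> \<Union> (cells ` set Ms) \<and>
    \<Union> (set_ltree ` set Ns) = \<Union> (set_ltree ` set Ls) \<union> \<Union> (set_ltree ` set Ms) \<and>
    ((\<forall>L\<in>set Ls. aligned t h L) \<and> (\<forall>M\<in>set Ms. aligned t h M) \<longrightarrow> (\<forall>N\<in>set Ns. aligned t h N))"

lemma graftedD:
  assumes "grafted t h Ls Ms Ns"
  shows "map root_edge Ns = map root_edge Ls" "concat (map leaves Ns) = concat (map leaves Ms)"
    "\<Union> (cells ` set Ns) = \<Union> (cells ` set Ls) \<union> \<Union> (cells ` set Ms)"
    "\<Union> (set_ltree ` set Ns) = \<Union> (set_ltree ` set Ls) \<union> \<Union> (set_ltree ` set Ms)"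
    "(\<forall>L\<in>set Ls. aligned t h L) \<Longrightarrow> (\<forall>M\<in>set Ms. aligned t h M) \<Longrightarrow> (\<forall>N\<in>set Ns. aligned t h N)"
  using assms unfolding grafted_def by - ((elim conjE, assumption)+, elim conjE, erule mp, intro conjI, assumption+)

lemma graft_tree_exists: "map root_edge Ms = leaves L \<Longrightarrow> \<exists>N. grafted t h [L] Ms [N]"
proof (induction L arbitrary: Ms)
  case (LTip e)
  then obtain M where "Ms = [M]" "root_edge M = e" by auto
  then show ?case using root_in_set[of M] by (intro exI[of _ M]) (auto simp: grafted_def)
next
  case (LFork e l r)
  then obtain Ms1 Ms2 where Ms: "Ms = Ms1 @ Ms2" "map root_edge Ms1 = leaves l" "map root_edge Ms2 = leaves r"
    by (auto simp: map_eq_append_conv)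
  from LFork.IH(1)[OF Ms(2)] obtain N1 where N1: "grafted t h [l] Ms1 [N1]" ..
  from LFork.IH(2)[OF Ms(3)] obtain N2 where N2: "grafted t h [r] Ms2 [N2]" ..
  have "grafted t h [LFork e l r] Ms [LFork e N1 N2]"
    using N1 N2 by (simp add: grafted_def Ms(1) ball_Un Un_ac)
  then show ?case ..
qed

lemma graft_forest_exists: "map root_edge Ms = concat (map leaves Ls) \<Longrightarrow> \<exists>Ns. grafted t h Ls Ms Ns"
proof (induction Ls arbitrary: Ms)
  case (Cons L Ls)
  then obtain Ms1 Ms2 where Ms: "Ms = Ms1 @ Ms2" "map root_edge Ms1 = leaves L"
      "map root_edge Ms2 = concat (map leaves Ls)"
    by (auto simp: map_eq_append_conv)
  from graft_tree_exists[OF Ms(2)] obtain N where N: "grafted t h [L] Ms1 [N]" ..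
  from Cons.IH[OF Ms(3)] obtain Ns where Ns: "grafted t h Ls Ms2 Ns" ..
  have "grafted t h (L # Ls) Ms (N # Ns)"
    unfolding grafted_def
  proof (intro conjI)
    note n = graftedD[OF N] graftedD[OF Ns]
    show "map root_edge (N # Ns) = map root_edge (L # Ls)" using n(1,6) by simp
    show "concat (map leaves (N # Ns)) = concat (map leaves Ms)" using n(2,7) by (simp add: Ms(1))
    from n(3,4,8,9)    show "\<Union> (cells ` set (N # Ns)) = \<Union> (cells ` set (L # Ls)) \<union> \<Union> (cells ` set Ms)"
      "\<Union> (set_ltree ` set (N # Ns)) = \<Union> (set_ltree ` set (L # Ls)) \<union> \<Union> (set_ltree ` set Ms)"
      by (simp_all only: Ms(1) set_append image_Un Union_Un_distrib list.set image_insert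
          image_empty Union_empty Un_empty_right Un_empty_left Union_insert Un_ac)
    show "(\<forall>L\<in>set (L # Ls). aligned t h L) \<and> (\<forall>M\<in>set Ms. aligned t h M) \<longrightarrow>
        (\<forall>N\<in>set (N # Ns). aligned t h N)"
    proof (intro impI, elim conjE)
      assume "\<forall>L\<in>set (L # Ls). aligned t h L" "\<forall>M\<in>set Ms. aligned t h M"
      then have a: "\<forall>L\<in>set [L]. aligned t h L" "\<forall>L\<in>set Ls. aligned t h L"
        "\<forall>M\<in>set Ms1. aligned t h M" "\<forall>M\<in>set Ms2. aligned t h M"
        unfolding Ms(1) by simp_all
      show "\<forall>N\<in>set (N # Ns). aligned t h N" using n(5)[OF a(1,3)] n(10)[OF a(2,4)] by simp
    qed
  qed
  then show ?case ..
qed (auto simp: grafted_def intro: exI[of _ "[]"])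

text \<open>Every vertex of the upper forest lies on its bottom path, hence belongs to the lower one as
  well; so the lower forest supplies all vertices of the composition.\<close>

lemma forest_diag_dcomp:
  assumes D1: "forest_diag D1 Ls1" and D2: "forest_diag D2 Ls2"
    and comp: "compatible (dgraph D1) (dgraph D2)" and mid: "dbot D1 = dtop D2"
    and verts: "set (edge_verts (tail (dgraph D1)) (head (dgraph D1)) (dbot D1)) \<subseteq> verts (dgraph D2)"
  shows "\<exists>Ls. forest_diag (dcomp D1 D2) Ls"
proof -
  let ?t = "tail (dgraph D1)" and ?h = "head (dgraph D1)"
  have th: "tail (dgraph D2) = ?t" "head (dgraph D2) = ?h"
    using comp by (auto simp: compatible_def)
  have "map root_edge Ls2 = concat (map leaves Ls1)" using D1 D2 mid by (simp add: forest_diag_def)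
  from graft_forest_exists[OF this] obtain Ns where Ns: "grafted ?t ?h Ls1 Ls2 Ns" ..
  have "\<forall>L\<in>set Ls1. aligned ?t ?h L" "\<forall>L\<in>set Ls2. aligned ?t ?h L"
    using forest_diagD(6)[OF D1] forest_diagD(6)[OF D2] th by simp_all
  note n = graftedD(1-4)[OF Ns] graftedD(5)[OF Ns this]
  have "Ns \<noteq> []" using n(1) forest_diagD(1)[OF D1] by auto
  have "verts (dgraph D1) \<subseteq> verts (dgraph D2)" using D1 verts by (simp add: forest_diag_def)
  with \<open>Ns \<noteq> []\<close> have "forest_diag (dcomp D1 D2) Ns"
    using forest_diagD[OF D1] forest_diagD[OF D2] th n
    unfolding forest_diag_def dcomp_def Digraph_Component.union_def
    by (simp add: Un_absorb1)
  then show ?thesis ..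
qed

text \<open>All cells are \<open>\<pi>\<close> rather than \<open>\<pi>\<^sup>-\<^sup>1\<close>: their top paths are single edges.\<close>

definition positive_diag :: "('v, 'e) diag \<Rightarrow> bool" where
  "positive_diag D \<longleftrightarrow> (\<forall>(p, q)\<in>dcells D. length p = 1)"

lemma dinv_dinv [simp]: "dinv (dinv D) = D"
  by (simp add: dinv_def image_image case_prod_beta)

lemma dinv_simps [simp]:
  "dgraph (dinv D) = dgraph D" "dtop (dinv D) = dbot D" "dbot (dinv D) = dtop D"
  "dcells (dinv D) = (\<lambda>(p, q). (q, p)) ` dcells D"
  by (simp_all add: dinv_def)

lemma dcells_dinv_iff [simp]: "(p, q) \<in> (\<lambda>(p, q). (q, p)) ` C \<longleftrightarrow> (q, p) \<in> C"
  by auto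

lemma dinv_dsum: "dinv (dsum D1 D2) = dsum (dinv D1) (dinv D2)"
  by (auto simp: dinv_def dsum_def image_Un)

lemma dinv_dcomp:
  "compatible (dgraph D1) (dgraph D2) \<Longrightarrow> dinv (dcomp D1 D2) = dcomp (dinv D2) (dinv D1)"
  by (auto simp: dinv_def dcomp_def image_Un compatible_def Digraph_Component.union_def)

lemma compatible_sym: "compatible G H \<Longrightarrow> compatible H G"
  by (auto simp: compatible_def)

lemma path_verts_eq:
  "es \<noteq> [] \<Longrightarrow> chained (tail (dgraph D)) (head (dgraph D)) es \<Longrightarrow>
    path_verts D es = set (edge_verts (tail (dgraph D)) (head (dgraph D)) es)"
  by (simp add: path_verts_def awalk_verts_eq_edge_verts)

text \<open>The statement about the inverse makes the induction go through reflections, since a positive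
  diagram may be built from the inverse of a negative one.\<close>

lemma diagram_forests:
  "diagram D \<Longrightarrow> (positive_diag D \<longrightarrow> (\<exists>Ls. forest_diag D Ls)) \<and>
    (positive_diag (dinv D) \<longrightarrow> (\<exists>Ls. forest_diag (dinv D) Ls))"
proof (induction rule: diagram.induct)
  case (edge t e h)
  then show ?case
    by (auto intro!: exI[of _ "[LTip e]"] simp: forest_diag_def chained_def edge_verts_def)
next
  case (pi u v w e e1 e2 t h)
  then show ?case
    by (auto intro!: exI[of _ "[LFork e (LTip e1) (LTip e2)]"]
        simp: forest_diag_def chained_def edge_verts_def positive_diag_def)
next
  case (sum D1 D2)
  have *: "compatible (dgraph D1) (dgraph D2)" "dterm D1 = dinit D2"
    "verts (dgraph D1) \<inter> verts (dgraph D2) = {dterm D1}"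
    using sum.hyps(3) by (auto simp: summable_diags_def)
  show ?case
  proof (intro conjI impI)
    assume "positive_diag (dsum D1 D2)"
    then have "positive_diag D1" "positive_diag D2" by (auto simp: positive_diag_def dsum_def)
    then show "\<exists>Ls. forest_diag (dsum D1 D2) Ls" using sum.IH forest_diag_dsum * by blast
  next
    assume "positive_diag (dinv (dsum D1 D2))"
    then have "positive_diag (dinv D1)" "positive_diag (dinv D2)" by (auto simp: positive_diag_def dsum_def)
    then obtain Ls1 Ls2 where Ls: "forest_diag (dinv D1) Ls1" "forest_diag (dinv D2) Ls2"
      using sum.IH by blast
    have "dterm (dinv D1) = dterm D1" "dinit (dinv D2) = dinit D2"
      using forest_diag_ends[OF Ls(1)] forest_diag_ends[OF Ls(2)] by (simp_all add: dterm_def dinit_def)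
    then show "\<exists>Ls. forest_diag (dinv (dsum D1 D2)) Ls"
      unfolding dinv_dsum using forest_diag_dsum[OF Ls] * by auto
  qed
next
  case (comp D1 D2)
  have *: "compatible (dgraph D1) (dgraph D2)" "dbot D1 = dtop D2"
    "path_verts D1 (dbot D1) = verts (dgraph D1) \<inter> verts (dgraph D2)"
    using comp.hyps(3) by (auto simp: composable_diags_def)
  show ?case
  proof (intro conjI impI)
    assume "positive_diag (dcomp D1 D2)"
    then have "positive_diag D1" "positive_diag D2" by (auto simp: positive_diag_def dcomp_def)
    then obtain Ls1 Ls2 where Ls: "forest_diag D1 Ls1" "forest_diag D2 Ls2"
      using comp.IH by blast
    then show "\<exists>Ls. forest_diag (dcomp D1 D2) Ls"
      using forest_diag_dcomp[OF Ls *(1,2)] *(3) path_verts_eq[OF forest_diag_ends(4,3)[OF Ls(1)]]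
      by (metis Int_lower2)
  next
    assume "positive_diag (dinv (dcomp D1 D2))"
    then have "positive_diag (dinv D1)" "positive_diag (dinv D2)" by (auto simp: positive_diag_def dcomp_def)
    then obtain Ls1 Ls2 where Ls: "forest_diag (dinv D1) Ls1" "forest_diag (dinv D2) Ls2"
      using comp.IH by blast
    have "tail (dgraph D2) = tail (dgraph D1)" "head (dgraph D2) = head (dgraph D1)"
      using *(1) by (auto simp: compatible_def)
    moreover have "dtop D2 \<noteq> []" "chained (tail (dgraph D2)) (head (dgraph D2)) (dtop D2)"
      using forest_diag_ends[OF Ls(2)] by auto
    ultimately show "\<exists>Ls. forest_diag (dinv (dcomp D1 D2)) Ls"
      using forest_diag_dcomp[OF Ls(2,1)] * path_verts_eq[of "dtop D2" D1] compatible_sym[OF *(1)]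
      by (simp add: dinv_dcomp)
  qed
next
  case (inv D)
  then show ?case by simp
qed

section \<open>Reduced diagrams split into a positive and a negative half\<close>

text \<open>Every edge is reached from above in one way only: it lies on the top path or at the bottom of
  exactly one cell. The same property of the inverse describes the way down.\<close>

definition top_inv :: "('v, 'e) diag \<Rightarrow> bool" where
  "top_inv D \<longleftrightarrow> set (dtop D) \<subseteq> arcs (dgraph D) \<and>
    (\<forall>c a. c \<in> dcells D \<longrightarrow> a \<in> set (snd c) \<longrightarrow> a \<in> arcs (dgraph D) \<and> a \<notin> set (dtop D)) \<and>
    (\<forall>a. a \<in> arcs (dgraph D) \<longrightarrow> a \<in> set (dtop D) \<or> (\<exists>c. c \<in> dcells D \<and> a \<in> set (snd c))) \<and>
    (\<forall>c c' a. c \<in> dcells D \<longrightarrow> c' \<in> dcells D \<longrightarrow> a \<in> set (snd c) \<longrightarrow> a \<in> set (snd c') \<longrightarrow> c = c')"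

definition pi_cells :: "('v, 'e) diag \<Rightarrow> bool" where
  "pi_cells D \<longleftrightarrow> (\<forall>c\<in>dcells D. \<exists>e e1 e2. e1 \<noteq> e2 \<and> (c = ([e], [e1, e2]) \<or> c = ([e1, e2], [e])))"

lemma top_invD:
  assumes "top_inv D"
  shows "a \<in> set (dtop D) \<Longrightarrow> a \<in> arcs (dgraph D)"
    "c \<in> dcells D \<Longrightarrow> a \<in> set (snd c) \<Longrightarrow> a \<in> arcs (dgraph D)"
    "c \<in> dcells D \<Longrightarrow> a \<in> set (snd c) \<Longrightarrow> a \<notin> set (dtop D)"
    "a \<in> arcs (dgraph D) \<Longrightarrow> a \<notin> set (dtop D) \<Longrightarrow> \<exists>c. c \<in> dcells D \<and> a \<in> set (snd c)"
    "c \<in> dcells D \<Longrightarrow> c' \<in> dcells D \<Longrightarrow> a \<in> set (snd c) \<Longrightarrow> a \<in> set (snd c') \<Longrightarrow> c = c'"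
proof -
  note h = assms[unfolded top_inv_def]
  note c = conjunct1[OF h] conjunct1[OF conjunct2[OF h]]
    conjunct1[OF conjunct2[OF conjunct2[OF h]]] conjunct2[OF conjunct2[OF conjunct2[OF h]]]
  show "a \<in> set (dtop D) \<Longrightarrow> a \<in> arcs (dgraph D)" using c(1) by (rule subsetD)
  show "c \<in> dcells D \<Longrightarrow> a \<in> set (snd c) \<Longrightarrow> a \<in> arcs (dgraph D)"
    "c \<in> dcells D \<Longrightarrow> a \<in> set (snd c) \<Longrightarrow> a \<notin> set (dtop D)"
    using c(2) by metis+
  show "a \<in> arcs (dgraph D) \<Longrightarrow> a \<notin> set (dtop D) \<Longrightarrow> \<exists>c. c \<in> dcells D \<and> a \<in> set (snd c)"
    using c(3) by metis
  show "c \<in> dcells D \<Longrightarrow> c' \<in> dcells D \<Longrightarrow> a \<in> set (snd c) \<Longrightarrow> a \<in> set (snd c') \<Longrightarrow> c = c'"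
    using c(4) by metis
qed

text \<open>Sums and compositions at once: an edge of both parts is on the top path of the lower one, and
  so it is not the bottom edge of a cell of that part.\<close>

lemma top_inv_glue:
  assumes D1: "top_inv D1" and D2: "top_inv D2"
    and arcs: "arcs (dgraph D) = arcs (dgraph D1) \<union> arcs (dgraph D2)"
    and cells: "dcells D = dcells D1 \<union> dcells D2"
    and shared: "\<And>a. a \<in> arcs (dgraph D1) \<Longrightarrow> a \<in> arcs (dgraph D2) \<Longrightarrow> a \<in> set (dtop D2)"
    and top: "\<And>a. a \<in> set (dtop D1) \<Longrightarrow> a \<in> set (dtop D)"
      "\<And>a. a \<in> set (dtop D) \<Longrightarrow> a \<in> set (dtop D1) \<or> a \<in> set (dtop D2) \<and> a \<notin> arcs (dgraph D1)"
      "\<And>a. a \<in> set (dtop D2) \<Longrightarrow> a \<in> arcs (dgraph D1) \<or> a \<in> set (dtop D)"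
  shows "top_inv D"
  unfolding top_inv_def
proof (intro conjI allI impI subsetI)
  fix a assume "a \<in> set (dtop D)"
  then show "a \<in> arcs (dgraph D)" using top(2) top_invD(1)[OF D1] top_invD(1)[OF D2] arcs by blast
next
  fix c a assume c: "c \<in> dcells D" "a \<in> set (snd c)"
  then show "a \<in> arcs (dgraph D)" using cells top_invD(2)[OF D1] top_invD(2)[OF D2] arcs by blast
  consider "c \<in> dcells D1" | "c \<in> dcells D2" using c cells by blast
  then show "a \<notin> set (dtop D)"
  proof cases
    case 1
    then show ?thesis using top(2) top_invD(2,3)[OF D1] c by blast
  next
    case 2
    then show ?thesis using top(2) top_invD(1)[OF D1] top_invD(2,3)[OF D2] c shared by blast
  qed
next
  fix a assume "a \<in> arcs (dgraph D)"
  then show "a \<in> set (dtop D) \<or> (\<exists>c. c \<in> dcells D \<and> a \<in> set (snd c))"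
    using arcs cells top(1,3) top_invD(4)[OF D1] top_invD(4)[OF D2] by blast
next
  fix c c' a assume c: "c \<in> dcells D" "c' \<in> dcells D" "a \<in> set (snd c)" "a \<in> set (snd c')"
  have False if "d \<in> dcells D1" "d' \<in> dcells D2" "a \<in> set (snd d)" "a \<in> set (snd d')" for d d'
    using that top_invD(2)[OF D1] top_invD(2,3)[OF D2] shared by blast
  then show "c = c'" using c cells top_invD(5)[OF D1] top_invD(5)[OF D2] by blast
qed

lemma top_inv_dsum:
  assumes "top_inv D1" "top_inv D2" "arcs (dgraph D1) \<inter> arcs (dgraph D2) = {}"
  shows "top_inv (dsum D1 D2)"
  using assms(1,2)
  by (rule top_inv_glue)
    (use assms(3) top_invD(1)[OF assms(2)] in \<open>auto simp: dsum_def Digraph_Component.union_def\<close>)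

lemma top_inv_dcomp:
  assumes "top_inv D1" "top_inv D2" "arcs (dgraph D1) \<inter> arcs (dgraph D2) = set (dtop D2)"
  shows "top_inv (dcomp D1 D2)"
  using assms(1,2)
  by (rule top_inv_glue) (use assms(3) in \<open>auto simp: dcomp_def Digraph_Component.union_def\<close>)

lemma diagram_invariants:
  "diagram D \<Longrightarrow> top_inv D \<and> top_inv (dinv D) \<and> pi_cells D"
proof (induction rule: diagram.induct)
  case (sum D1 D2)
  then have "arcs (dgraph D1) \<inter> arcs (dgraph D2) = {}" by (simp add: summable_diags_def)
  moreover have "pi_cells (dsum D1 D2)"
    using sum.IH unfolding pi_cells_def dsum_def by (simp add: ball_Un)
  ultimately show ?case using sum.IH by (simp add: dinv_dsum top_inv_dsum)
next
  case (comp D1 D2)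
  then have "compatible (dgraph D1) (dgraph D2)"
    "arcs (dgraph D1) \<inter> arcs (dgraph D2) = set (dtop D2)" "dbot D1 = dtop D2"
    by (simp_all add: composable_diags_def)
  moreover have "pi_cells (dcomp D1 D2)"
    using comp.IH unfolding pi_cells_def dcomp_def by (simp add: ball_Un)
  ultimately show ?case using comp.IH by (simp add: dinv_dcomp top_inv_dcomp Int_commute)
next
  case (inv D)
  then show ?case by (auto simp: pi_cells_def)
qed (auto simp: top_inv_def pi_cells_def)

definition inverse_dipole :: "('v, 'e) diag \<Rightarrow> bool" where
  "inverse_dipole D \<longleftrightarrow>
    (\<exists>e e1 e2 e1' e2'. ([e1, e2], [e]) \<in> dcells D \<and> ([e], [e1', e2']) \<in> dcells D)"

definition negative_at_bottom :: "('v, 'e) diag \<Rightarrow> bool" where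
  "negative_at_bottom D \<longleftrightarrow> ((\<exists>x y e. ([x, y], [e]) \<in> dcells D) \<longrightarrow>
    (\<exists>x y e. ([x, y], [e]) \<in> dcells D \<and> e \<in> set (dbot D)))"

lemma inverse_dipole_dinv: "inverse_dipole (dinv D) = inverse_dipole D"
  by (auto simp: inverse_dipole_def)

lemma negative_at_bottom_dsum:
  "negative_at_bottom D1 \<Longrightarrow> negative_at_bottom D2 \<Longrightarrow> negative_at_bottom (dsum D1 D2)"
  unfolding negative_at_bottom_def dsum_def by (simp, blast)

text \<open>A cell \<open>\<pi>\<^sup>-\<^sup>1\<close> of the upper part reaches the common path. The edge below it either continues to
  the bottom path or meets a cell of the lower part; this is no \<open>\<pi>\<close>, which would form a dipole, hence
  it is again a \<open>\<pi>\<^sup>-\<^sup>1\<close>.\<close>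

lemma negative_at_bottom_dcomp:
  assumes "negative_at_bottom D1" "negative_at_bottom D2" "\<not> inverse_dipole (dcomp D1 D2)"
    and "top_inv (dinv D2)" "pi_cells D2" "dbot D1 = dtop D2" "set (dtop D2) \<subseteq> arcs (dgraph D2)"
  shows "negative_at_bottom (dcomp D1 D2)"
  unfolding negative_at_bottom_def
proof
  assume neg: "\<exists>x y e. ([x, y], [e]) \<in> dcells (dcomp D1 D2)"
  show "\<exists>x y e. ([x, y], [e]) \<in> dcells (dcomp D1 D2) \<and> e \<in> set (dbot (dcomp D1 D2))"
  proof (cases "\<exists>x y e. ([x, y], [e]) \<in> dcells D2")
    case True
    then show ?thesis using assms(2) by (auto simp: negative_at_bottom_def dcomp_def)
  next
    case False
    then have "\<exists>x y e. ([x, y], [e]) \<in> dcells D1" using neg by (auto simp: dcomp_def)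
    then obtain x y e where e: "([x, y], [e]) \<in> dcells D1" "e \<in> set (dtop D2)"
      using assms(1,6) by (auto simp: negative_at_bottom_def)
    then have "e \<in> set (dbot D2) \<or> (\<exists>p q. (p, q) \<in> dcells D2 \<and> e \<in> set p)"
    proof (cases "e \<in> set (dbot D2)")
      case False
      then obtain c where "c \<in> dcells (dinv D2)" "e \<in> set (snd c)"
        using top_invD(4)[OF assms(4), of e] assms(7) e(2) by (metis dinv_simps(1,2) subsetD)
      then show ?thesis by (cases c) auto
    qed simp
    moreover have False if pq: "(p, q) \<in> dcells D2" "e \<in> set p" for p q
    proof -
      obtain e' e1 e2 where "p = [e'] \<and> q = [e1, e2] \<or> p = [e1, e2] \<and> q = [e']"
        using assms(5) pq(1) unfolding pi_cells_def by blast
      then have "([e], [e1, e2]) \<in> dcells D2" using False pq by auto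
      then have "inverse_dipole (dcomp D1 D2)"
        using e(1) unfolding inverse_dipole_def dcomp_def by (simp, blast)
      then show False using assms(3) by simp
    qed
    ultimately have "e \<in> set (dbot D2)" by blast
    then show ?thesis using e by (auto simp: dcomp_def)
  qed
qed

text \<open>Below a cell \<open>\<pi>\<^sup>-\<^sup>1\<close> only further cells \<open>\<pi>\<^sup>-\<^sup>1\<close> can follow, down to the bottom
  path; dually for the cells \<open>\<pi>\<close> and the top path.\<close>

lemma diagram_negative_at_bottom:
  "diagram D \<Longrightarrow> \<not> inverse_dipole D \<Longrightarrow> negative_at_bottom D \<and> negative_at_bottom (dinv D)"
proof (induction rule: diagram.induct)
  case (sum D1 D2)
  then have "\<not> inverse_dipole D1" "\<not> inverse_dipole D2" by (auto simp: inverse_dipole_def dsum_def)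
  with sum.IH show ?case by (simp add: dinv_dsum negative_at_bottom_dsum)
next
  case (comp D1 D2)
  then have D: "\<not> inverse_dipole D1" "\<not> inverse_dipole D2"
    and "compatible (dgraph D1) (dgraph D2)" "dbot D1 = dtop D2"
    by (auto simp: inverse_dipole_def dcomp_def composable_diags_def)
  moreover have "set (dtop D2) \<subseteq> arcs (dgraph D2)" "set (dbot D1) \<subseteq> arcs (dgraph D1)"
    using diagram_invariants[OF comp.hyps(1)] diagram_invariants[OF comp.hyps(2)]
    by (auto simp: top_inv_def)
  moreover have "\<not> inverse_dipole (dcomp (dinv D2) (dinv D1))"
    using inverse_dipole_dinv[of "dcomp D1 D2"] comp.prems calculation by (simp add: dinv_dcomp)
  moreover have "pi_cells (dinv D1)"
    using diagram_invariants[OF comp.hyps(1)] by (auto simp: pi_cells_def)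
  ultimately show ?case
    using comp.IH comp.prems diagram_invariants[OF comp.hyps(1)] diagram_invariants[OF comp.hyps(2)]
    by (simp add: dinv_dcomp negative_at_bottom_dcomp)
next
  case (inv D)
  then show ?case by (simp add: inverse_dipole_dinv)
qed (auto simp: negative_at_bottom_def)

text \<open>Intervals are handed down only through cells \<open>\<pi>\<close>. If there were a cell \<open>\<pi>\<^sup>-\<^sup>1\<close>, then there
  would be one whose bottom edge is on the bottom path, and this edge would get no interval.\<close>

lemma assigned_imp_positive:
  assumes "diagram D" "\<not> inverse_dipole D" "\<forall>e\<in>set (dbot D). \<exists>a b. assigned D e a b"
  shows "positive_diag D"
proof (rule ccontr)
  assume "\<not> positive_diag D"
  then obtain p q where pq: "(p, q) \<in> dcells D" "length p \<noteq> 1" by (auto simp: positive_diag_def)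
  obtain x y e where "(p, q) = ([x, y], [e])"
    using diagram_invariants[OF assms(1)] pq by (fastforce simp: pi_cells_def)
  then obtain x y e where e: "([x, y], [e]) \<in> dcells D" "e \<in> set (dbot D)"
    using diagram_negative_at_bottom[OF assms(1,2)] pq unfolding negative_at_bottom_def by blast
  then obtain a b where "assigned D e a b" using assms(3) by blast
  moreover have inv: "top_inv D" using diagram_invariants[OF assms(1)] by simp
  moreover have "c = ([x, y], [e])" if "c \<in> dcells D" "e \<in> set (snd c)" for c
    using top_invD(5)[OF inv that(1) e(1) that(2)] by simp
  moreover have "e \<notin> set (dtop D)" using top_invD(3)[OF inv e(1)] by simp
  ultimately show False by cases fastforce+
qed

text \<open>An edge is at the bottom of at most one cell and not on the top path if there is one, so its
  interval has only one derivation.\<close>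

lemma assigned_unique:
  assumes "top_inv D" "pi_cells D" "assigned D e a b" "assigned D e a' b'"
  shows "a = a' \<and> b = b'"
proof -
  have uniq: "c = c'" if "c \<in> dcells D" "c' \<in> dcells D" "f \<in> set (snd c)" "f \<in> set (snd c')" for c c' f
    using top_invD(5)[OF assms(1)] that by blast
  have nottop: "dtop D \<noteq> [f]" if "c \<in> dcells D" "f \<in> set (snd c)" for c f
    using top_invD(3)[OF assms(1) that] by auto
  have ne: "f1 \<noteq> f2" if "([f], [f1, f2]) \<in> dcells D" for f f1 f2
    using assms(2) that unfolding pi_cells_def by fastforce
  have inv: "dtop D = [g] \<or>
      (\<exists>f c d g'. assigned D f c d \<and> ([f], [g, g']) \<in> dcells D \<and> x = c \<and> y = (c + d) / 2) \<or>
      (\<exists>f c d g'. assigned D f c d \<and> ([f], [g', g]) \<in> dcells D \<and> x = (c + d) / 2 \<and> y = d)"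
    if "assigned D g x y" for g x y
    using that by (cases rule: assigned.cases) auto
  show ?thesis
    using assms(3,4)
  proof (induction arbitrary: a' b')
    case (top e)
    from top(2) show ?case
      by (cases rule: assigned.cases) (use top(1) nottop in fastforce)+
  next
    case (left e a b e1 e2)
    have "dtop D \<noteq> [e1]" using nottop[OF left.hyps(2)] by simp
    moreover have "([f], [g', e1]) \<notin> dcells D" for f g'
      using uniq[OF left.hyps(2), of "([f], [g', e1])" e1] ne[of f g' e1] by auto
    ultimately obtain f c d g' where f: "assigned D f c d" "([f], [e1, g']) \<in> dcells D"
        "a' = c" "b' = (c + d) / 2"
      using inv[OF left.prems] by blast
    moreover have "f = e" using uniq[OF left.hyps(2) f(2), of e1] by simp
    ultimately show ?case using left.IH by blast
  next
    case (right e a b e1 e2)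
    have "dtop D \<noteq> [e2]" using nottop[OF right.hyps(2)] by simp
    moreover have "([f], [e2, g']) \<notin> dcells D" for f g'
      using uniq[OF right.hyps(2), of "([f], [e2, g'])" e2] ne[of f e2 g'] by auto
    ultimately obtain f c d g' where f: "assigned D f c d" "([f], [g', e2]) \<in> dcells D"
        "a' = (c + d) / 2" "b' = d"
      using inv[OF right.prems] by blast
    moreover have "f = e" using uniq[OF right.hyps(2) f(2), of e2] by simp
    ultimately show ?case using right.IH by blast
  qed
qed

section \<open>Path lengths in the Thompson graph\<close>

text \<open>With vertices numbered from left to right, every edge spans the leaves below it.\<close>

fun spans :: "('e \<Rightarrow> nat) \<Rightarrow> ('e \<Rightarrow> nat) \<Rightarrow> nat \<Rightarrow> 'e ltree \<Rightarrow> bool" where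
  "spans lo hi i (LTip e) = (lo e = i \<and> hi e = Suc i)"
| "spans lo hi i (LFork e l r) = (lo e = i \<and> hi e = i + tips (shape l) + tips (shape r) \<and>
    spans lo hi i l \<and> spans lo hi (i + tips (shape l)) r)"

text \<open>The step that \<open>above\<close> makes at a cell \<open>\<pi>\<close>: its top edge and the right one of its bottom
  edges have the same head.\<close>

definition right_steps :: "'e ltree \<Rightarrow> ('e \<times> 'e) set" where
  "right_steps L = {(e, r). \<exists>l. ([e], [l, r]) \<in> cells L}"

lemma right_steps_simps [simp]:
  "right_steps (LTip e) = {}"
  "right_steps (LFork e l r) = insert (e, root_edge r) (right_steps l \<union> right_steps r)"
  by (auto simp: right_steps_def)

lemma tips_pos: "tips T > 0"
  by simp

lemma spans_root: "spans lo hi i L \<Longrightarrow> lo (root_edge L) = i \<and> hi (root_edge L) = i + tips (shape L)"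
  by (cases L) auto

lemma spans_range:
  "spans lo hi i L \<Longrightarrow> a \<in> set_ltree L \<Longrightarrow> i \<le> lo a \<and> lo a < hi a \<and> hi a \<le> i + tips (shape L)"
proof (induction L arbitrary: i)
  case (LFork e l r)
  then show ?case
    using tips_pos[of "shape l"] tips_pos[of "shape r"] by (fastforce simp del: length_greater_0_conv)
qed auto

lemma cells_in_set:
  "c \<in> cells L \<Longrightarrow> set (fst c) \<union> set (snd c) \<subseteq> set_ltree L"
  by (induction L) auto

lemma spans_cells:
  assumes "spans lo hi i L" "([e], [l, r]) \<in> cells L"
  shows "lo l = lo e \<and> hi l = lo r \<and> hi r = hi e \<and> lo l < hi l \<and> lo r < hi r"
  using assms
proof (induction L arbitrary: i)
  case (LFork f x y)
  show ?case
  proof (cases "([e], [l, r]) = ([f], [root_edge x, root_edge y])")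
    case True
    then show ?thesis using LFork.prems(1) spans_root[of lo hi i x]
        spans_root[of lo hi "i + tips (shape x)" y] tips_pos[of "shape x"] tips_pos[of "shape y"]
      by (simp del: length_greater_0_conv)
  next
    case False
    then show ?thesis using LFork by auto
  qed
qed auto

lemma spans_leaves:
  "spans lo hi i L \<Longrightarrow> j < tips (shape L) \<Longrightarrow> lo (leaves L ! j) = i + j \<and> hi (leaves L ! j) = Suc (i + j)"
  by (induction L arbitrary: i j) (auto simp: nth_append)

lemma spans_right_steps:
  assumes "spans lo hi i L" "(x, y) \<in> right_steps L"
  shows "x \<in> set_ltree L" "y \<in> set_ltree L" "hi y = hi x" "lo x + 1 < hi x" "lo x < lo y"
proof -
  obtain l where l: "([x], [l, y]) \<in> cells L" using assms(2) by (auto simp: right_steps_def)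
  show "x \<in> set_ltree L" "y \<in> set_ltree L" using cells_in_set[OF l] by auto
  show "hi y = hi x" "lo x + 1 < hi x" "lo x < lo y" using spans_cells[OF assms(1) l] by auto
qed

lemma right_spine:
  "spans lo hi i L \<Longrightarrow> a \<in> set_ltree L \<Longrightarrow> hi a = i + tips (shape L) \<Longrightarrow>
    (root_edge L, a) \<in> (right_steps L)\<^sup>*"
proof (induction L arbitrary: i)
  case (LFork e l r)
  note n = tips_pos[of "shape l"] tips_pos[of "shape r"]
  consider "a = e" | "a \<in> set_ltree l" | "a \<in> set_ltree r" using LFork.prems by auto
  then show ?case
  proof cases
    case 2
    then show ?thesis using spans_range[of lo hi i l a] LFork.prems n by (simp del: length_greater_0_conv)
  next
    case 3
    then have "(root_edge r, a) \<in> (right_steps r)\<^sup>*"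
      using LFork.IH(2)[of "i + tips (shape l)"] LFork.prems by (simp add: add.assoc)
    then have "(root_edge r, a) \<in> (right_steps (LFork e l r))\<^sup>*"
      by (rule rtrancl_mono[THEN subsetD, rotated]) auto
    then show ?thesis by (rule converse_rtrancl_into_rtrancl[rotated]) simp
  qed simp
qed simp

lemma right_steps_to_leaf:
  "spans lo hi i L \<Longrightarrow> a \<in> set_ltree L \<Longrightarrow> hi a = Suc (i + j) \<Longrightarrow> j < tips (shape L) \<Longrightarrow>
    (a, leaves L ! j) \<in> (right_steps L)\<^sup>*"
proof (induction L arbitrary: i j a)
  case (LFork e l r)
  note n = tips_pos[of "shape l"] tips_pos[of "shape r"]
  have L: "(x, y) \<in> (right_steps (LFork e l r))\<^sup>*" if "(x, y) \<in> (right_steps l)\<^sup>*" for x y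
    using that by (rule rtrancl_mono[THEN subsetD, rotated]) auto
  have R: "(x, y) \<in> (right_steps (LFork e l r))\<^sup>*" if "(x, y) \<in> (right_steps r)\<^sup>*" for x y
    using that by (rule rtrancl_mono[THEN subsetD, rotated]) auto
  have r: "(b, leaves (LFork e l r) ! j) \<in> (right_steps (LFork e l r))\<^sup>*"
    if "b \<in> set_ltree r" "hi b = Suc (i + j)" for b
  proof -
    have "tips (shape l) \<le> j"
      using spans_range[of lo hi "i + tips (shape l)" r b] LFork.prems(1) that by auto
    then have "leaves (LFork e l r) ! j = leaves r ! (j - tips (shape l))"
      by (simp add: nth_append)
    moreover have "(b, leaves r ! (j - tips (shape l))) \<in> (right_steps r)\<^sup>*"
      using \<open>tips (shape l) \<le> j\<close> LFork.IH(2)[of "i + tips (shape l)" b "j - tips (shape l)"]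
        LFork.prems that by simp
    ultimately show ?thesis using R by simp
  qed
  consider "a = e" | "a \<in> set_ltree l" | "a \<in> set_ltree r" using LFork.prems by auto
  then show ?case
  proof cases
    case 1
    then have "hi (root_edge r) = Suc (i + j)"
      using LFork.prems spans_root[of lo hi "i + tips (shape l)" r] by simp
    then have "(root_edge r, leaves (LFork e l r) ! j) \<in> (right_steps (LFork e l r))\<^sup>*" by (intro r) simp
    then show ?thesis by (rule converse_rtrancl_into_rtrancl[rotated]) (simp add: 1)
  next
    case 2
    then have "j < tips (shape l)" using spans_range[of lo hi i l a] LFork.prems by simp
    then have "leaves (LFork e l r) ! j = leaves l ! j" by (simp add: nth_append)
    moreover have "(a, leaves l ! j) \<in> (right_steps l)\<^sup>*"
      using LFork.IH(1)[of i a j] LFork.prems 2 \<open>j < tips (shape l)\<close> by simp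
    ultimately show ?thesis using L by simp
  next
    case 3
    then show ?thesis using r LFork.prems by blast
  qed
qed auto

lemma nth_labels_0 [simp]: "labels T ! 0 = 0"
  using hd_labels[of T] by (metis hd_conv_nth labels_not_Nil)

text \<open>For the vertex to the left of leaf \<open>j\<close>, let \<open>u\<close> be the left child of the fork at which the
  addresses of the leaves \<open>j - 1\<close> and \<open>j\<close> part. The edges that end at this vertex form the right spine
  of \<open>u\<close>. The tail of \<open>u\<close> is at the first leaf \<open>j'\<close> of its subtree, which is reached with one right
  turn less than leaf \<open>j\<close>.\<close>

lemma topmost_edge:
  assumes "spans lo hi i L" "0 < j" "j < tips (shape L)"
  shows "\<exists>u j'. u \<in> set_ltree L \<and> hi u = i + j \<and> lo u = i + j' \<and> j' < j \<and>
    labels (shape L) ! j = Suc (labels (shape L) ! j') \<and>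
    (\<forall>a\<in>set_ltree L. hi a = i + j \<longrightarrow> (u, a) \<in> (right_steps L)\<^sup>*)"
  using assms
proof (induction L arbitrary: i j)
  case (LFork e l r)
  define k where "k = tips (shape l)"
  have sp: "spans lo hi i l" "spans lo hi (i + k) r" "hi e = i + k + tips (shape r)"
    using LFork.prems by (auto simp: k_def)
  have L: "(x, y) \<in> (right_steps (LFork e l r))\<^sup>*" if "(x, y) \<in> (right_steps l)\<^sup>*" for x y
    using that by (rule rtrancl_mono[THEN subsetD, rotated]) auto
  have R: "(x, y) \<in> (right_steps (LFork e l r))\<^sup>*" if "(x, y) \<in> (right_steps r)\<^sup>*" for x y
    using that by (rule rtrancl_mono[THEN subsetD, rotated]) auto
  have hl: "hi a \<le> i + k" if "a \<in> set_ltree l" for a using spans_range[OF sp(1) that] k_def by simp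
  have hr: "i + k < hi a" if "a \<in> set_ltree r" for a using spans_range[OF sp(2) that] by simp
  have kpos: "0 < k" using tips_pos unfolding k_def .
  have len: "length (labels (shape l)) = k" "length (labels (shape r)) = tips (shape r)"
    by (simp_all add: k_def)
  have j: "j < k + tips (shape r)" using LFork.prems by (simp add: k_def)
  consider "j < k" | "j = k" | "k < j" by linarith
  then show ?case
  proof cases
    case 1
    obtain u j' where u: "u \<in> set_ltree l" "hi u = i + j" "lo u = i + j'" "j' < j"
      "labels (shape l) ! j = Suc (labels (shape l) ! j')"
      "\<forall>a\<in>set_ltree l. hi a = i + j \<longrightarrow> (u, a) \<in> (right_steps l)\<^sup>*"
      using LFork.IH(1)[OF sp(1) \<open>0 < j\<close>] 1 unfolding k_def by blast
    have "(u, a) \<in> (right_steps (LFork e l r))\<^sup>*" if "a \<in> set_ltree (LFork e l r)" "hi a = i + j" for a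
      using that u(6) L hr[of a] 1 sp(3) by fastforce
    moreover have "labels (shape (LFork e l r)) ! j = Suc (labels (shape (LFork e l r)) ! j')"
      using 1 u(4,5) len by (simp add: nth_append)
    ultimately show ?thesis using u by (intro exI[of _ u] exI[of _ j']) simp
  next
    case 2
    have "(root_edge l, a) \<in> (right_steps (LFork e l r))\<^sup>*"
      if "a \<in> set_ltree (LFork e l r)" "hi a = i + j" for a
    proof -
      have "a \<in> set_ltree l" using that hr[of a] 2 sp(3) j by auto
      then show ?thesis using right_spine[OF sp(1)] that 2 by (intro L) (simp add: k_def)
    qed
    moreover have "labels (shape (LFork e l r)) ! j = Suc (labels (shape (LFork e l r)) ! 0)"
      using 2 len kpos j by (simp add: nth_append)
    moreover have "lo (root_edge l) = i" "hi (root_edge l) = i + j"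
      using spans_root[OF sp(1)] 2 k_def by auto
    ultimately show ?thesis using LFork.prems by (intro exI[of _ "root_edge l"] exI[of _ 0]) simp
  next
    case 3
    have "0 < j - k" "j - k < tips (shape r)" using 3 j by auto
    then obtain u j' where u: "u \<in> set_ltree r" "hi u = (i + k) + (j - k)" "lo u = (i + k) + j'" "j' < j - k"
      "labels (shape r) ! (j - k) = Suc (labels (shape r) ! j')"
      "\<forall>a\<in>set_ltree r. hi a = (i + k) + (j - k) \<longrightarrow> (u, a) \<in> (right_steps r)\<^sup>*"
      using LFork.IH(2)[OF sp(2)] by blast
    have "(u, a) \<in> (right_steps (LFork e l r))\<^sup>*" if "a \<in> set_ltree (LFork e l r)" "hi a = i + j" for a
    proof -
      have "a \<in> set_ltree r" using that hl[of a] 3 sp(3) j by auto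
      then show ?thesis using u(6) that 3 by (intro R) simp
    qed
    moreover have "labels (shape (LFork e l r)) ! j = Suc (labels (shape (LFork e l r)) ! (k + j'))"
      using 3 j u(4,5) len by (simp add: nth_append)
    ultimately show ?thesis using u 3 by (intro exI[of _ u] exI[of _ "k + j'"]) simp
  qed
qed auto

lemma cas_snoc:
  "pre_digraph.cas G u (p @ [a]) v \<longleftrightarrow> pre_digraph.cas G u p (tail G a) \<and> head G a = v"
  by (induction p arbitrary: u) (auto simp: pre_digraph.cas.simps)

text \<open>The shape of reduced diagrams: a tree of cells \<open>\<pi>\<close> above a tree of cells \<open>\<pi>\<^sup>-\<^sup>1\<close>
  with the same leaves, and vertices numbered along the common path.\<close>

locale tree_pair_diagram =
  fixes D :: "('v, 'e) diag" and L1 L2 :: "'e ltree" and pos :: "'v \<Rightarrow> nat"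
  assumes top: "dtop D = [root_edge L1]" and bot: "dbot D = [root_edge L2]"
    and same_leaves: "leaves L1 = leaves L2"
    and dcells_eq: "dcells D = cells L1 \<union> (\<lambda>(p, q). (q, p)) ` cells L2"
    and arcs_eq: "arcs (dgraph D) = set_ltree L1 \<union> set_ltree L2"
    and shared: "set_ltree L1 \<inter> set_ltree L2 \<subseteq> set (leaves L1)"
    and pos: "bij_betw pos (verts (dgraph D)) {..tips (shape L1)}"
    and ends: "a \<in> arcs (dgraph D) \<Longrightarrow> tail (dgraph D) a \<in> verts (dgraph D) \<and> head (dgraph D) a \<in> verts (dgraph D)"
    and spans1: "spans (pos \<circ> tail (dgraph D)) (pos \<circ> head (dgraph D)) 0 L1"
    and spans2: "spans (pos \<circ> tail (dgraph D)) (pos \<circ> head (dgraph D)) 0 L2"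
begin

abbreviation "N \<equiv> tips (shape L1)"
abbreviation "lo \<equiv> pos \<circ> tail (dgraph D)"
abbreviation "hi \<equiv> pos \<circ> head (dgraph D)"

lemma N_eq: "tips (shape L2) = N"
  using same_leaves by (metis length_leaves)

lemma pos_eq: "u \<in> verts (dgraph D) \<Longrightarrow> v \<in> verts (dgraph D) \<Longrightarrow> pos u = pos v \<Longrightarrow> u = v"
  using pos by (auto simp: bij_betw_def inj_on_def)

lemma init: "dinit D \<in> verts (dgraph D)" "pos (dinit D) = 0"
  using ends[of "root_edge L1"] spans_root[OF spans1] by (auto simp: dinit_def top arcs_eq)

lemma dterm: "dterm D \<in> verts (dgraph D)" "pos (dterm D) = N"
  using ends[of "root_edge L1"] spans_root[OF spans1] by (auto simp: dterm_def top arcs_eq)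

lemma inner_iff: "v \<in> inner_verts D \<longleftrightarrow> v \<in> verts (dgraph D) \<and> 0 < pos v \<and> pos v < N"
proof -
  have "pos v \<le> N" if "v \<in> verts (dgraph D)" using that pos by (auto simp: bij_betw_def)
  then show ?thesis
    using init dterm pos_eq unfolding inner_verts_def by (metis Diff_iff empty_iff insert_iff le_neq_implies_less neq0_conv less_irrefl)
qed

lemma above_eq: "above D = (right_steps L1 \<union> (right_steps L2)\<inverse>)\<^sup>*"
proof -
  have *: "(last p, last q) \<in> right_steps L" if "(p, q) \<in> cells L" for p q and L :: "'e ltree"
    using that by (induction L) auto
  have "{(last p, last q) | p q. (p, q) \<in> dcells D} = right_steps L1 \<union> (right_steps L2)\<inverse>"
  proof (intro equalityI subsetI)
    fix x assume "x \<in> {(last p, last q) | p q. (p, q) \<in> dcells D}"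
    then show "x \<in> right_steps L1 \<union> (right_steps L2)\<inverse>" using * by (auto simp: dcells_eq)
  next
    fix x assume "x \<in> right_steps L1 \<union> (right_steps L2)\<inverse>"
    then show "x \<in> {(last p, last q) | p q. (p, q) \<in> dcells D}"
      unfolding right_steps_def dcells_eq by force
  qed
  then show ?thesis by (simp add: above_def)
qed

text \<open>Going down through the cells, the intervals spanned by the edges shrink in the upper tree and
  grow again in the lower one. So this rank increases, and \<open>above\<close> is antisymmetric, which makes
  the topmost edge unique.\<close>

definition rank :: "'e \<Rightarrow> int" where
  "rank a = (if a \<in> set_ltree L1 then 1 - (int (hi a) - int (lo a)) else int (hi a) - int (lo a) - 1)"

lemma rank_leaf: "a \<in> set (leaves L1) \<Longrightarrow> int (hi a) - int (lo a) = 1"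
  using spans_leaves[OF spans1] by (force simp: in_set_conv_nth)

lemma rank_step:
  assumes "(x, y) \<in> right_steps L1 \<union> (right_steps L2)\<inverse>"
  shows "rank x < rank y"
  using assms
proof
  assume "(x, y) \<in> right_steps L1"
  from spans_right_steps[OF spans1 this] show ?thesis by (simp add: rank_def)
next
  assume "(x, y) \<in> (right_steps L2)\<inverse>"
  then have yx: "(y, x) \<in> right_steps L2" by simp
  note s = spans_right_steps[OF spans2 yx]
  have "y \<notin> set_ltree L1" using rank_leaf[of y] shared s by auto
  moreover have "rank x = int (hi x) - int (lo x) - 1"
    using rank_leaf[of x] shared s by (auto simp: rank_def)
  ultimately show ?thesis using s by (simp add: rank_def)
qed

lemma above_antisym: "(x, y) \<in> above D \<Longrightarrow> (y, x) \<in> above D \<Longrightarrow> x = y"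
proof -
  have "x = y \<or> rank x < rank y" if "(x, y) \<in> above D" for x y
    using that unfolding above_eq by (induction rule: rtrancl_induct) (use rank_step in fastforce)+
  then show "(x, y) \<in> above D \<Longrightarrow> (y, x) \<in> above D \<Longrightarrow> x = y" by (metis less_asym)
qed

lemma upper_edge:
  assumes "v \<in> inner_verts D"
  shows "upper_edge D v \<in> arcs (dgraph D)" "head (dgraph D) (upper_edge D v) = v"
    "pos (tail (dgraph D) (upper_edge D v)) < pos v"
    "labels (shape L1) ! pos v = Suc (labels (shape L1) ! pos (tail (dgraph D) (upper_edge D v)))"
proof -
  have v: "v \<in> verts (dgraph D)" "0 < pos v" "pos v < N" using assms inner_iff by auto
  obtain u j' where u: "u \<in> set_ltree L1" "hi u = pos v" "lo u = j'" "j' < pos v"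
    "labels (shape L1) ! pos v = Suc (labels (shape L1) ! j')"
    "\<forall>a\<in>set_ltree L1. hi a = pos v \<longrightarrow> (u, a) \<in> (right_steps L1)\<^sup>*"
    using topmost_edge[OF spans1 v(2,3)] by auto
  have L1: "(x, y) \<in> above D" if "(x, y) \<in> (right_steps L1)\<^sup>*" for x y
    using that unfolding above_eq by (rule rtrancl_mono[THEN subsetD, rotated]) auto
  have L2: "(y, x) \<in> above D" if "(x, y) \<in> (right_steps L2)\<^sup>*" for x y
  proof -
    have "(y, x) \<in> ((right_steps L2)\<inverse>)\<^sup>*" using that by (simp add: rtrancl_converse)
    then show ?thesis unfolding above_eq by (rule rtrancl_mono[THEN subsetD, rotated]) auto
  qed
  define f where "f = leaves L1 ! (pos v - 1)"
  have f: "f \<in> set_ltree L1" "hi f = pos v"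
  proof -
    have "f \<in> set (leaves L1)" using v by (simp add: f_def)
    then show "f \<in> set_ltree L1" by (rule subsetD[OF leaves_subset])
    show "hi f = pos v" using spans_leaves[OF spans1, of "pos v - 1"] v by (simp add: f_def)
  qed
  have uabove: "(u, a) \<in> above D" if "a \<in> in_arcs (dgraph D) v" for a
  proof -
    have a: "hi a = pos v" "a \<in> set_ltree L1 \<union> set_ltree L2" using that arcs_eq by auto
    show ?thesis
    proof (cases "a \<in> set_ltree L1")
      case True
      then show ?thesis using u(6) a L1 by blast
    next
      case False
      then have "(a, leaves L2 ! (pos v - 1)) \<in> (right_steps L2)\<^sup>*"
        using right_steps_to_leaf[OF spans2, of a "pos v - 1"] a v N_eq by simp
      then have "(f, a) \<in> above D" unfolding f_def same_leaves by (rule L2)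
      moreover have "(u, f) \<in> above D" using u(6) f L1 by blast
      ultimately show ?thesis unfolding above_eq by simp
    qed
  qed
  have uarc: "u \<in> arcs (dgraph D)" using u arcs_eq by auto
  have "head (dgraph D) u = v" using pos_eq v ends[OF uarc] u by simp
  then have "u \<in> in_arcs (dgraph D) v" using uarc by simp
  then have "upper_edge D v = u"
    unfolding upper_edge_def using uabove above_antisym by (intro the_equality) blast+
  then show "upper_edge D v \<in> arcs (dgraph D)" "head (dgraph D) (upper_edge D v) = v"
    "pos (tail (dgraph D) (upper_edge D v)) < pos v"
    "labels (shape L1) ! pos v = Suc (labels (shape L1) ! pos (tail (dgraph D) (upper_edge D v)))"
    using u uarc \<open>head (dgraph D) u = v\<close> by auto
qed

text \<open>Reflection exchanges the two trees, hence upper and lower edges.\<close>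

lemma dual: "tree_pair_diagram (dinv D) L2 L1 pos"
proof
  show "dcells (dinv D) = cells L2 \<union> (\<lambda>(p, q). (q, p)) ` cells L1"
    unfolding dinv_simps dcells_eq by (simp add: image_Un image_image case_prod_beta Un_commute)
qed (use top bot same_leaves arcs_eq shared pos ends spans1 spans2 N_eq in auto)

lemma lower_edge_dual: "lower_edge D v = upper_edge (dinv D) v"
proof -
  interpret dual: tree_pair_diagram "dinv D" L2 L1 pos by (rule dual)
  have "above (dinv D) = (above D)\<inverse>"
    unfolding above_eq dual.above_eq rtrancl_converse[symmetric] by (simp add: Un_commute converse_Un)
  then show ?thesis by (simp add: lower_edge_def upper_edge_def)
qed

lemma inner_dual: "inner_verts (dinv D) = inner_verts D"
proof -
  interpret dual: tree_pair_diagram "dinv D" L2 L1 pos by (rule dual)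
  show ?thesis using inner_iff dual.inner_iff N_eq by auto
qed

text \<open>Paths of one side are traced back uniquely from their end by the chosen incoming edges, and
  \<open>g\<close> counts the steps.\<close>

lemma length_side_path:
  assumes E: "\<And>v. v \<in> inner_verts D \<Longrightarrow> E v \<in> arcs (dgraph D) \<and> head (dgraph D) (E v) = v \<and>
      pos (tail (dgraph D) (E v)) < pos v \<and> g (pos v) = Suc (g (pos (tail (dgraph D) (E v))))"
    and g: "g 0 = 0" and arcs: "\<And>e. (s, e) \<in> arcs (thompson_graph D) \<longleftrightarrow> e \<in> E ` inner_verts D"
    and v: "v \<in> inner_verts D"
  shows "length (side_path D s v) = g (pos v)"
proof -
  let ?P = "\<lambda>w p. set p \<subseteq> arcs (thompson_graph D) \<and>
    pre_digraph.cas (thompson_graph D) (dinit D) p w \<and> (\<forall>a\<in>set p. fst a = s)"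
  have th: "tail (thompson_graph D) a = tail (dgraph D) (snd a)"
    "head (thompson_graph D) a = head (dgraph D) (snd a)" for a
    by (simp_all add: thompson_graph_def)
  have snoc: "?P w (p @ [a]) \<longleftrightarrow> w \<in> inner_verts D \<and> a = (s, E w) \<and> ?P (tail (dgraph D) (E w)) p"
    for w p a
  proof -
    have "a \<in> arcs (thompson_graph D) \<and> fst a = s \<and> head (dgraph D) (snd a) = w \<longleftrightarrow>
        w \<in> inner_verts D \<and> a = (s, E w)"
    proof
      assume a: "a \<in> arcs (thompson_graph D) \<and> fst a = s \<and> head (dgraph D) (snd a) = w"
      then have "snd a \<in> E ` inner_verts D" using arcs[of "snd a"] by (metis prod.collapse)
      then obtain w' where "w' \<in> inner_verts D" "snd a = E w'" by blast
      then show "w \<in> inner_verts D \<and> a = (s, E w)" using a E[of w'] by (metis prod.collapse)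
    next
      assume "w \<in> inner_verts D \<and> a = (s, E w)"
      then show "a \<in> arcs (thompson_graph D) \<and> fst a = s \<and> head (dgraph D) (snd a) = w"
        using arcs E by auto
    qed
    then show ?thesis by (auto simp: cas_snoc th)
  qed
  have "\<exists>p. (\<forall>q. ?P w q \<longleftrightarrow> q = p) \<and> length p = g (pos w)" if "w = dinit D \<or> w \<in> inner_verts D" for w
    using that
  proof (induction "pos w" arbitrary: w rule: less_induct)
    case less
    show ?case
    proof (cases "w = dinit D")
      case True
      then have "w \<notin> inner_verts D" using init inner_iff by simp
      then have "?P w q \<longleftrightarrow> q = []" for q
        using True snoc[where w = w and p = "butlast q" and a = "last q"] by (cases "q = []") (auto simp: pre_digraph.cas.simps)
      then show ?thesis using True init g by auto
    next
      case False
      then have w: "w \<in> inner_verts D" using less.prems by simp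
      define t where "t = tail (dgraph D) (E w)"
      have "t \<in> verts (dgraph D)" "pos t < pos w" using E[OF w] ends by (auto simp: t_def)
      moreover have "pos w < N" using w inner_iff by simp
      ultimately have "t = dinit D \<or> t \<in> inner_verts D"
        using inner_iff init pos_eq by (metis gr0I order.strict_trans)
      then obtain p where p: "\<forall>q. ?P t q \<longleftrightarrow> q = p" "length p = g (pos t)"
        using less.hyps[OF \<open>pos t < pos w\<close>] by blast
      have "?P w q \<longleftrightarrow> q = p @ [(s, E w)]" for q
      proof (cases "q = []")
        case True
        then show ?thesis using False by (auto simp: pre_digraph.cas.simps)
      next
        case False
        then obtain q' a where q: "q = q' @ [a]" by (metis rev_exhaust)
        show ?thesis unfolding q snoc t_def[symmetric] using p(1) w by auto
      qed
      then show ?thesis using p(2) E[OF w] by (intro exI[of _ "p @ [(s, E w)]"]) (simp add: t_def)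
    qed
  qed
  then obtain p where p: "\<forall>q. ?P v q \<longleftrightarrow> q = p" "length p = g (pos v)" using v by blast
  have "dinit D \<noteq> dterm D" using init dterm tips_pos[of "shape L1"] by (auto simp del: length_greater_0_conv)
  then have "dinit D \<in> verts (thompson_graph D)" using init by (simp add: thompson_graph_def)
  then have "side_path D s v = (THE q. ?P v q)"
    by (simp add: side_path_def pre_digraph.awalk_def conj_assoc)
  also have "\<dots> = p" using p(1) by (intro the_equality) blast+
  finally show ?thesis using p(2) by simp
qed

lemma good_iff: "good m D \<longleftrightarrow> cong_lists m (labels (shape L1)) (labels (shape L2))"
proof -
  interpret dual: tree_pair_diagram "dinv D" L2 L1 pos by (rule dual)
  have up: "length (side_path D Upper v) = labels (shape L1) ! pos v" if "v \<in> inner_verts D" for v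
    by (rule length_side_path[of "upper_edge D"])
      (use upper_edge that in \<open>auto simp: thompson_graph_def\<close>)
  have lo: "length (side_path D Lower v) = labels (shape L2) ! pos v" if "v \<in> inner_verts D" for v
    by (rule length_side_path[of "lower_edge D"])
      (use dual.upper_edge[folded lower_edge_dual, unfolded inner_dual] that
        in \<open>auto simp: thompson_graph_def\<close>)
  have "good m D \<longleftrightarrow>
      (\<forall>v\<in>inner_verts D. [labels (shape L1) ! pos v = labels (shape L2) ! pos v] (mod m))"
    using up lo by (simp add: good_def)
  also have "\<dots> \<longleftrightarrow> (\<forall>j<N. [labels (shape L1) ! j = labels (shape L2) ! j] (mod m))"
  proof (intro iffI allI impI ballI)
    fix j assume *: "\<forall>v\<in>inner_verts D. [labels (shape L1) ! pos v = labels (shape L2) ! pos v] (mod m)"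
      and j: "j < N"
    have "j \<in> pos ` verts (dgraph D)" using pos j by (auto simp: bij_betw_def)
    then obtain v where "v \<in> verts (dgraph D)" "pos v = j" by blast
    then show "[labels (shape L1) ! j = labels (shape L2) ! j] (mod m)"
      using * j inner_iff[of v] by (cases "j = 0") auto
  qed (auto simp: inner_iff)
  also have "\<dots> \<longleftrightarrow> cong_lists m (labels (shape L1)) (labels (shape L2))"
    by (simp add: cong_lists_def list_all2_conv_all_nth N_eq)
  finally show ?thesis .
qed

text \<open>Edges increase the position; hence the common path, which visits every position, is a
  longest positive path.\<close>

lemma cas_length:
  "set p \<subseteq> arcs (dgraph D) \<Longrightarrow> pre_digraph.cas (dgraph D) u p v \<Longrightarrow> pos u + length p \<le> pos v"
proof (induction p arbitrary: u)
  case (Cons a p)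
  have "lo a < hi a"
    using Cons.prems(1) spans_range[OF spans1, of a] spans_range[OF spans2, of a] arcs_eq by auto
  then show ?case using Cons by (fastforce simp: pre_digraph.cas.simps)
qed (auto simp: pre_digraph.cas.simps)

end

section \<open>Tree pairs of reduced diagrams\<close>

lemma length_edge_verts [simp]: "length (edge_verts t h es) = Suc (length es)"
  by (simp add: edge_verts_def)

lemma edge_verts_nth:
  assumes "chained t h es" "j < length es"
  shows "edge_verts t h es ! j = t (es ! j)" "edge_verts t h es ! Suc j = h (es ! j)"
proof -
  show "edge_verts t h es ! Suc j = h (es ! j)" using assms(2) by (simp add: edge_verts_def)
  show "edge_verts t h es ! j = t (es ! j)"
  proof (cases j)
    case 0
    then show ?thesis using assms(2) by (simp add: edge_verts_def hd_conv_nth)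
  next
    case (Suc i)
    then show ?thesis using assms by (auto simp: edge_verts_def chained_def successively_conv_nth)
  qed
qed

lemma spans_aligned:
  assumes "aligned t h L"
    and "\<And>j. j < tips (shape L) \<Longrightarrow> pos (t (leaves L ! j)) = i + j \<and> pos (h (leaves L ! j)) = Suc (i + j)"
  shows "spans (pos \<circ> t) (pos \<circ> h) i L"
  using assms
proof (induction L arbitrary: i)
  case (LFork e l r)
  have l: "spans (pos \<circ> t) (pos \<circ> h) i l"
  proof (rule LFork.IH(1))
    show "aligned t h l" using LFork.prems(1) by simp
    fix j assume "j < tips (shape l)"
    then show "pos (t (leaves l ! j)) = i + j \<and> pos (h (leaves l ! j)) = Suc (i + j)"
      using LFork.prems(2)[of j] by (simp add: nth_append)
  qed
  have r: "spans (pos \<circ> t) (pos \<circ> h) (i + tips (shape l)) r"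
  proof (rule LFork.IH(2))
    show "aligned t h r" using LFork.prems(1) by simp
    fix j assume "j < tips (shape r)"
    then show "pos (t (leaves r ! j)) = i + tips (shape l) + j \<and>
        pos (h (leaves r ! j)) = Suc (i + tips (shape l) + j)"
      using LFork.prems(2)[of "tips (shape l) + j"] by (simp add: nth_append add.assoc)
  qed
  show ?case using l r spans_root[OF l] spans_root[OF r] LFork.prems(1) by (simp add: comp_def)
qed auto

lemma aligned_edge_ends:
  "aligned t h L \<Longrightarrow> a \<in> set_ltree L \<Longrightarrow> t a \<in> t ` set (leaves L) \<and> h a \<in> h ` set (leaves L)"
proof (induction L)
  case (LFork e l r)
  have "t (hd (leaves l)) = t e" "h (last (leaves r)) = h e"
    using aligned_leaves[of t h l] aligned_leaves[of t h r] LFork.prems by auto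
  moreover have "hd (leaves l) \<in> set (leaves l)" "last (leaves r) \<in> set (leaves r)" by simp_all
  ultimately have "t e \<in> t ` set (leaves l)" "h e \<in> h ` set (leaves r)" by (metis imageI)+
  then show ?case using LFork by auto
qed simp

text \<open>The vertices of both halves are those of the common path, and the position of a vertex is
  its index on this path.\<close>

lemma tree_pair_diagram_exists:
  assumes Dp: "forest_diag Dp [L1]" and Dm: "forest_diag (dinv Dm) [L2]"
    and comp: "composable_diags Dp Dm"
  shows "\<exists>pos. tree_pair_diagram (dcomp Dp Dm) L1 L2 pos"
proof -
  let ?t = "tail (dgraph Dp)" and ?h = "head (dgraph Dp)"
  have th: "tail (dgraph Dm) = ?t" "head (dgraph Dm) = ?h" "dtop Dm = dbot Dp"
    and arcs: "arcs (dgraph Dp) \<inter> arcs (dgraph Dm) = set (dbot Dp)"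
    using comp by (auto simp: composable_diags_def compatible_def)
  note p = forest_diagD[OF Dp, simplified] and m = forest_diagD[OF Dm, simplified, unfolded th]
  define vs where "vs = edge_verts ?t ?h (leaves L1)"
  have same: "leaves L2 = leaves L1" using p(3) m(3) th by simp
  have vs: "distinct vs" "verts (dgraph Dp) = set vs" "verts (dgraph Dm) = set vs"
    "length vs = Suc (tips (shape L1))"
    using p m same th by (simp_all add: vs_def)
  define pos where "pos = inv_into {..<length vs} ((!) vs)"
  have bij: "bij_betw pos (set vs) {..<length vs}"
    unfolding pos_def using vs(1) by (intro bij_betw_inv_into bij_betw_nth) auto
  have pos: "pos (vs ! j) = j" if "j < length vs" for j
    unfolding pos_def using that vs(1) by (intro inv_into_f_f) (auto simp: inj_on_def nth_eq_iff_index_eq)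
  have al: "aligned ?t ?h L1" "aligned ?t ?h L2" using p(6) m(6) by simp_all
  have ch: "chained ?t ?h (leaves L1)" using aligned_leaves[OF al(1)] by simp
  have leafpos: "pos (?t (leaves L1 ! j)) = 0 + j \<and> pos (?h (leaves L1 ! j)) = Suc (0 + j)"
    if "j < tips (shape L1)" for j
    using edge_verts_nth[OF ch, of j] pos[of j] pos[of "Suc j"] that vs(4) unfolding vs_def by simp
  have k: "tips (shape L2) = tips (shape L1)" using same by (metis length_leaves)
  have sub: "?t ` set (leaves L1) \<subseteq> set vs" "?h ` set (leaves L1) \<subseteq> set vs"
  proof -
    show "?h ` set (leaves L1) \<subseteq> set vs" by (auto simp: vs_def edge_verts_def)
    show "?t ` set (leaves L1) \<subseteq> set vs"
    proof
      fix x assume "x \<in> ?t ` set (leaves L1)"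
      then obtain j where "j < length (leaves L1)" "x = ?t (leaves L1 ! j)" by (auto simp: in_set_conv_nth)
      then show "x \<in> set vs"
        using edge_verts_nth(1)[OF ch] vs(4) unfolding vs_def by (metis length_edge_verts less_SucI nth_mem)
    qed
  qed
  have "tree_pair_diagram (dcomp Dp Dm) L1 L2 pos"
  proof
    show "dtop (dcomp Dp Dm) = [root_edge L1]" "dbot (dcomp Dp Dm) = [root_edge L2]"
      using p m by (simp_all add: dcomp_def)
    show "leaves L1 = leaves L2" by (simp add: same)
    have "dcells Dm = (\<lambda>(p, q). (q, p)) ` cells L2"
      using forest_diagD(4)[OF Dm] by (metis (no_types) dinv_dinv dinv_simps(4) Union_insert Union_empty
          Un_empty_right image_empty image_insert list.set)
    then show "dcells (dcomp Dp Dm) = cells L1 \<union> (\<lambda>(p, q). (q, p)) ` cells L2"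
      using p by (simp add: dcomp_def)
    show "arcs (dgraph (dcomp Dp Dm)) = set_ltree L1 \<union> set_ltree L2"
      using p m by (simp add: dcomp_def Digraph_Component.union_def)
    show "set_ltree L1 \<inter> set_ltree L2 \<subseteq> set (leaves L1)"
      using arcs p m by simp
    show "bij_betw pos (verts (dgraph (dcomp Dp Dm))) {..tips (shape L1)}"
      using bij vs by (simp add: dcomp_def Digraph_Component.union_def lessThan_Suc_atMost)
    show "spans (pos \<circ> tail (dgraph (dcomp Dp Dm))) (pos \<circ> head (dgraph (dcomp Dp Dm))) 0 L1"
      using spans_aligned[OF al(1), of pos 0] leafpos by (simp add: dcomp_def Digraph_Component.union_def)
    show "spans (pos \<circ> tail (dgraph (dcomp Dp Dm))) (pos \<circ> head (dgraph (dcomp Dp Dm))) 0 L2"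
      using spans_aligned[OF al(2), of pos 0] leafpos
      by (simp add: dcomp_def Digraph_Component.union_def same k)
    fix a assume "a \<in> arcs (dgraph (dcomp Dp Dm))"
    then consider "a \<in> set_ltree L1" | "a \<in> set_ltree L2"
      using p m by (auto simp: dcomp_def Digraph_Component.union_def)
    then have "?t a \<in> set vs \<and> ?h a \<in> set vs"
      using aligned_edge_ends[OF al(1)] aligned_edge_ends[OF al(2)] sub same
      by cases (metis subsetD)+
    then show "tail (dgraph (dcomp Dp Dm)) a \<in> verts (dgraph (dcomp Dp Dm)) \<and>
        head (dgraph (dcomp Dp Dm)) a \<in> verts (dgraph (dcomp Dp Dm))"
      using vs by (simp add: dcomp_def Digraph_Component.union_def)
  qed
  then show ?thesis by (rule exI[of _ pos])
qed

lemma act_convex: "act w t = act w 0 + (act w 1 - act w 0) * t"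
  using act_affine[of w t] act_affine[of w 1] by simp

lemma assigned_leaf:
  assumes "assigned D (root_edge L) a b" "cells L \<subseteq> dcells D" "j < tips (shape L)"
  shows "assigned D (leaves L ! j) (a + (b - a) * act (addr (shape L) ! j) 0)
    (a + (b - a) * act (addr (shape L) ! j) 1)"
  using assms
proof (induction L arbitrary: a b j)
  case (LFork e l r)
  have c: "([e], [root_edge l, root_edge r]) \<in> dcells D" and lr: "cells l \<subseteq> dcells D" "cells r \<subseteq> dcells D"
    using LFork.prems(2) by auto
  have e: "assigned D e a b" using LFork.prems(1) by simp
  show ?case
  proof (cases "j < tips (shape l)")
    case True
    have "a + ((a + b) / 2 - a) * x = a + (b - a) * ((x + 0) / 2)" for x :: real
      by (simp add: field_simps)
    then show ?thesis
      using LFork.IH(1)[OF assigned.left[OF e c] lr(1) True] True by (simp add: nth_append)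
  next
    case False
    define i where "i = j - tips (shape l)"
    have i: "i < tips (shape r)" using LFork.prems(3) False by (simp add: i_def)
    have "(a + b) / 2 + (b - (a + b) / 2) * x = a + (b - a) * ((x + 1) / 2)" for x :: real
      by (simp add: field_simps)
    then show ?thesis
      using LFork.IH(2)[OF assigned.right[OF e c] lr(2) i] False i by (simp add: nth_append i_def)
  qed
qed simp

lemma forest_assigned:
  assumes "forest_diag D [L]" "j < tips (shape L)"
  shows "assigned D (leaves L ! j) (act (addr (shape L) ! j) 0) (act (addr (shape L) ! j) 1)"
  using assigned_leaf[of D L 0 1 j] assigned.top[of D "root_edge L"] forest_diagD[OF assms(1)] assms(2)
  by simp

lemma reduced_no_inverse_dipole:
  assumes "reduced D" "dcells E \<subseteq> dcells D"
  shows "\<not> inverse_dipole E"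
  using assms unfolding reduced_def has_dipole_def inverse_dipole_def by (meson subsetD)

lemma assigned_imp_tree:
  assumes "diagram D" "\<not> inverse_dipole D" "length (dtop D) = 1"
    and "\<forall>e\<in>set (dbot D). \<exists>a b. assigned D e a b"
  shows "\<exists>L. forest_diag D [L]"
proof -
  obtain Ls where Ls: "forest_diag D Ls"
    using diagram_forests[OF assms(1)] assigned_imp_positive[OF assms(1,2,4)] by blast
  then have "length Ls = 1" using forest_diagD(2)[OF Ls] assms(3) by simp
  then obtain L where "Ls = [L]" by (auto simp: length_Suc_conv)
  then show ?thesis using Ls by blast
qed

text \<open>The cut of the diagram has intervals assigned to all edges of the common path from both
  sides. This forces the upper part to be positive and the lower part to be negative, and the assigned
  intervals are the leaf intervals of the two trees.\<close>

theorem reduced_diagram_tree_pair: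
  assumes D: "diagram_in_F D" "reduced D" and f: "corresponds D f"
  shows "\<exists>L1 L2 pos. tree_pair_diagram D L1 L2 pos \<and> tree_rep 1 f (shape L1) (shape L2)"
proof -
  obtain Dp Dm where cut: "diagram Dp" "diagram Dm" "composable_diags Dp Dm" "D = dcomp Dp Dm"
    and ext: "f \<in> extensional {0..1}"
    and as: "\<forall>e\<in>set (dbot Dp). \<exists>a b c d. assigned Dp e a b \<and> assigned (dinv Dm) e c d \<and>
        (\<forall>t\<in>{a..b}. f t = c + (d - c) / (b - a) * (t - a))"
    using f by (auto simp: corresponds_def diagram_cut_def)
  have mid: "dtop Dm = dbot Dp" using cut(3) by (simp add: composable_diags_def)
  have "\<not> inverse_dipole Dp" "\<not> inverse_dipole Dm"
    using reduced_no_inverse_dipole[OF D(2), of Dp] reduced_no_inverse_dipole[OF D(2), of Dm] cut(4)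
    by (simp_all add: dcomp_def)
  moreover have "length (dtop Dp) = 1" "length (dbot Dm) = 1"
    using D(1) cut(4) by (simp_all add: diagram_in_F_def dcomp_def)
  ultimately obtain L1 L2 where L1: "forest_diag Dp [L1]" and L2: "forest_diag (dinv Dm) [L2]"
    using assigned_imp_tree[OF cut(1)] assigned_imp_tree[OF diagram.inv[OF cut(2)]] as mid
    by (metis dinv_simps(2,3) inverse_dipole_dinv)
  obtain pos where T: "tree_pair_diagram D L1 L2 pos"
    using tree_pair_diagram_exists[OF L1 L2 cut(3)] cut(4) by blast
  have same: "leaves L2 = leaves L1" using T by (simp add: tree_pair_diagram_def)
  have k: "tips (shape L2) = tips (shape L1)" using same by (metis length_leaves)
  have "f (act (addr (shape L1) ! j) s) = act (addr (shape L2) ! j) s"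
    if j: "j < tips (shape L1)" and s: "s \<in> {0..1}" for j s
  proof -
    define v w where "v = addr (shape L1) ! j" and "w = addr (shape L2) ! j"
    have "leaves L1 ! j \<in> set (dbot Dp)" using forest_diagD(3)[OF L1] j by simp
    then obtain a b c d where a: "assigned Dp (leaves L1 ! j) a b" "assigned (dinv Dm) (leaves L1 ! j) c d"
      and lin: "\<forall>t\<in>{a..b}. f t = c + (d - c) / (b - a) * (t - a)"
      using as by meson
    have "a = act v 0 \<and> b = act v 1"
      using assigned_unique[OF _ _ a(1) forest_assigned[OF L1 j]] diagram_invariants[OF cut(1)]
      unfolding v_def by blast
    moreover have "c = act w 0 \<and> d = act w 1"
      using assigned_unique[OF _ _ a(2)] forest_assigned[OF L2, of j] j k same
        diagram_invariants[OF diagram.inv[OF cut(2)]]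
      unfolding w_def by metis
    moreover have "act v s \<in> {act v 0..act v 1}" using s by simp
    moreover have "act v 1 - act v 0 \<noteq> 0" by simp
    moreover have "act v s - act v 0 = (act v 1 - act v 0) * s" using act_convex[of v s] by simp
    ultimately have "f (act v s) = act w 0 + (act w 1 - act w 0) * s"
      using lin by (simp del: act_eq_iff)
    then show ?thesis using act_convex[of w s] by (simp add: v_def w_def)
  qed
  then have "tree_rep 1 f (shape L1) (shape L2)"
    using ext k by (simp add: tree_rep_def leaf_map_def list_all2_conv_all_nth)
  then show ?thesis using T by blast
qed

corollary jones_subgroup_subset: "jones_subgroup m \<subseteq> tree_group m"
proof
  fix f assume "f \<in> jones_subgroup m"
  then obtain D :: "(nat, nat) diag" where D: "diagram_in_F D" "reduced D" "good m D" "corresponds D f"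
    by (auto simp: jones_subgroup_def)
  obtain L1 L2 pos where T: "tree_pair_diagram D L1 L2 pos" and f: "tree_rep 1 f (shape L1) (shape L2)"
    using reduced_diagram_tree_pair[OF D(1,2,4)] by blast
  have "cong_lists m (labels (shape L1)) (labels (shape L2))"
    using tree_pair_diagram.good_iff[OF T] D(3) by blast
  then show "f \<in> tree_group m" using f tree_rep_iff_labels unfolding tree_group_def by blast
qed

section \<open>Diagrams of tree pairs\<close>

definition tree_diag :: "('e \<Rightarrow> nat) \<Rightarrow> ('e \<Rightarrow> nat) \<Rightarrow> 'e ltree \<Rightarrow> (nat, 'e) diag" where
  "tree_diag t h L = \<lparr>dgraph = \<lparr>verts = set (edge_verts t h (leaves L)), arcs = set_ltree L,
      tail = t, head = h\<rparr>, dcells = cells L, dtop = [root_edge L], dbot = leaves L\<rparr>"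

lemma spans_imp_aligned: "spans t h i L \<Longrightarrow> aligned t h L"
proof (induction L arbitrary: i)
  case (LFork e l r)
  then have "spans t h i l" "spans t h (i + tips (shape l)) r" by auto
  from spans_root[OF this(1)] spans_root[OF this(2)] show ?case using LFork by auto
qed simp

lemma edge_verts_spans:
  assumes "spans t h i L"
  shows "edge_verts t h (leaves L) = [i..<Suc (i + tips (shape L))]"
proof (rule nth_equalityI)
  fix j assume j: "j < length (edge_verts t h (leaves L))"
  have ch: "chained t h (leaves L)" using aligned_leaves[OF spans_imp_aligned[OF assms]] by simp
  show "edge_verts t h (leaves L) ! j = [i..<Suc (i + tips (shape L))] ! j"
  proof (cases "j < tips (shape L)")
    case True
    then show ?thesis using edge_verts_nth(1)[OF ch, of j] spans_leaves[OF assms, of j]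
      by (simp del: upt_Suc)
  next
    case False
    then obtain k where k: "j = Suc k" "k < tips (shape L)"
      using j tips_pos[of "shape L"] by (cases j) (auto simp del: length_greater_0_conv)
    then show ?thesis using edge_verts_nth(2)[OF ch, of k] spans_leaves[OF assms, of k] j
      by (simp del: upt_Suc)
  qed
qed (simp del: upt_Suc)

lemma verts_tree_diag: "spans t h i L \<Longrightarrow> verts (dgraph (tree_diag t h L)) = {i..i + tips (shape L)}"
  by (simp add: tree_diag_def edge_verts_spans atLeastLessThanSuc_atLeastAtMost del: upt_Suc)

lemma tree_diag_forest: "spans t h i L \<Longrightarrow> forest_diag (tree_diag t h L) [L]"
  using spans_imp_aligned edge_verts_spans[of t h i L]
  by (auto simp: forest_diag_def tree_diag_def chained_def)

text \<open>A fork is the cell at its root composed with the sum of its subtrees.\<close>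

lemma diagram_tree_diag: "spans t h i L \<Longrightarrow> diagram (tree_diag t h L)"
proof (induction L arbitrary: i)
  case (LTip e)
  then have "t e \<noteq> h e" by simp
  from diagram.edge[of t e h, OF this] show ?case by (simp add: tree_diag_def edge_verts_def)
next
  case (LFork e l r)
  define k where "k = tips (shape l)"
  define n where "n = tips (shape r)"
  have sp: "spans t h i l" "spans t h (i + k) r" "t e = i" "h e = i + k + n" and pos: "k > 0" "n > 0"
    using LFork.prems tips_pos unfolding k_def n_def by auto
  have ro: "t (root_edge l) = i" "h (root_edge l) = i + k" "t (root_edge r) = i + k" "h (root_edge r) = i + k + n"
    using spans_root[OF sp(1)] spans_root[OF sp(2)] by (simp_all add: k_def n_def)
  let ?l = "tree_diag t h l" and ?r = "tree_diag t h r"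
  define P where "P = \<lparr>dgraph = \<lparr>verts = {i, i + k, i + k + n}, arcs = {e, root_edge l, root_edge r},
      tail = t, head = h\<rparr>, dcells = {([e], [root_edge l, root_edge r])}, dtop = [e], dbot = [root_edge l, root_edge r]\<rparr>"
  have "e \<noteq> root_edge l" using ro(2) sp(4) pos(2) by auto
  moreover have "e \<noteq> root_edge r" using ro(3) sp(3) pos(1) by auto
  moreover have "root_edge l \<noteq> root_edge r" using ro(1,3) pos(1) by auto
  ultimately have "diagram P" unfolding P_def using ro sp(3,4) pos by (intro diagram.pi) simp_all
  have v: "verts (dgraph ?l) = {i..i + k}" "verts (dgraph ?r) = {i + k..i + k + n}"
    using verts_tree_diag[OF sp(1)] verts_tree_diag[OF sp(2)] by (simp_all add: k_def n_def)
  have range: "a \<in> set_ltree l \<Longrightarrow> i \<le> t a \<and> t a < h a \<and> h a \<le> i + k"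
    "a \<in> set_ltree r \<Longrightarrow> i + k \<le> t a \<and> t a < h a \<and> h a \<le> i + k + n" for a
    using spans_range[OF sp(1), of a] spans_range[OF sp(2), of a] by (simp_all add: k_def n_def)
  have disj: "a \<notin> set_ltree r" if "a \<in> set_ltree l" for a using range[of a] that by auto
  have "summable_diags ?l ?r"
    unfolding summable_diags_def
  proof (intro conjI)
    show "verts (dgraph ?l) \<inter> verts (dgraph ?r) = {dterm ?l}"
      unfolding v using ro by (auto simp: tree_diag_def dterm_def)
  qed (use disj ro in \<open>auto simp: tree_diag_def dterm_def dinit_def compatible_def\<close>)
  then have S: "diagram (dsum ?l ?r)" using LFork.IH(1)[OF sp(1)] LFork.IH(2)[OF sp(2)] by (intro diagram.sum)
  have e: "e \<notin> set_ltree l" "e \<notin> set_ltree r" using range[of e] sp(3,4) pos by auto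
  have "composable_diags P (dsum ?l ?r)"
    unfolding composable_diags_def
  proof (intro conjI)
    show "verts (dgraph P) \<inter> verts (dgraph (dsum ?l ?r)) = path_verts P (dbot P)"
      using v ro by (auto simp: P_def dsum_def Digraph_Component.union_def path_verts_def
          pre_digraph.awalk_verts.simps)
    show "arcs (dgraph P) \<inter> arcs (dgraph (dsum ?l ?r)) = set (dbot P)"
      using e by (auto simp: P_def dsum_def Digraph_Component.union_def tree_diag_def)
  qed (simp_all add: P_def dsum_def tree_diag_def compatible_def Digraph_Component.union_def)
  with \<open>diagram P\<close> S have "diagram (dcomp P (dsum ?l ?r))" by (rule diagram.comp)
  moreover have "dcomp P (dsum ?l ?r) = tree_diag t h (LFork e l r)"
  proof -
    have "verts (dgraph P) \<union> (verts (dgraph ?l) \<union> verts (dgraph ?r))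
        = verts (dgraph (tree_diag t h (LFork e l r)))"
      unfolding v verts_tree_diag[OF LFork.prems] using pos by (auto simp: P_def k_def n_def)
    then show ?thesis
      by (auto simp: dcomp_def dsum_def tree_diag_def Digraph_Component.union_def P_def)
  qed
  ultimately show ?case by simp
qed

text \<open>Edges are named by a tag and their end points; leaves get the tag 2 on both sides, so that
  the bottom path of the upper half is the top path of the lower half.\<close>

definition edge_name :: "nat \<Rightarrow> nat \<Rightarrow> nat \<Rightarrow> nat" where
  "edge_name s i j = prod_encode (s, prod_encode (i, j))"

definition name_tag :: "nat \<Rightarrow> nat" where
  "name_tag e = fst (prod_decode e)"

definition name_tail :: "nat \<Rightarrow> nat" where
  "name_tail e = fst (prod_decode (snd (prod_decode e)))"

definition name_head :: "nat \<Rightarrow> nat" where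
  "name_head e = snd (prod_decode (snd (prod_decode e)))"

lemma name_simps [simp]:
  "name_tag (edge_name s i j) = s" "name_tail (edge_name s i j) = i" "name_head (edge_name s i j) = j"
  by (simp_all add: edge_name_def name_tag_def name_tail_def name_head_def)

fun name_tree :: "nat \<Rightarrow> nat \<Rightarrow> btree \<Rightarrow> nat ltree" where
  "name_tree s i Tip = LTip (edge_name 2 i (Suc i))"
| "name_tree s i (Fork l r) = LFork (edge_name s i (i + tips l + tips r))
    (name_tree s i l) (name_tree s (i + tips l) r)"

lemma shape_name_tree [simp]: "shape (name_tree s i T) = T"
  by (induction T arbitrary: i) auto

lemma spans_name_tree: "spans name_tail name_head i (name_tree s i T)"
  by (induction T arbitrary: i) auto

lemma leaves_name_tree:
  "leaves (name_tree s i T) = map (\<lambda>j. edge_name 2 j (Suc j)) [i..<i + tips T]"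
proof (induction T arbitrary: i)
  case (Fork l r)
  have "[i..<i + tips (Fork l r)] = [i..<i + tips l] @ [i + tips l..<i + tips l + tips r]"
    using upt_add_eq_append[of i "i + tips l" "tips r"] by (simp add: add.assoc)
  then show ?case using Fork by simp
qed simp

lemma name_tree_tags: "a \<in> set_ltree (name_tree s i T) \<Longrightarrow> a \<in> set (leaves (name_tree s i T)) \<or> name_tag a = s"
  by (induction T arbitrary: i) auto

lemma name_tree_shared:
  "set_ltree (name_tree 0 0 S) \<inter> set_ltree (name_tree 1 0 T) \<subseteq> set (leaves (name_tree 0 0 S))"
proof
  fix a assume "a \<in> set_ltree (name_tree 0 0 S) \<inter> set_ltree (name_tree 1 0 T)"
  then show "a \<in> set (leaves (name_tree 0 0 S))"
    using name_tree_tags[of a 0 0 S] name_tree_tags[of a 1 0 T] by (auto simp: leaves_name_tree)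
qed

definition caret_at :: "nat \<Rightarrow> nat \<Rightarrow> btree list" where
  "caret_at n j = (replicate n Tip)[j := Fork Tip Tip]"

text \<open>If both bottom edges of a cell are leaves, the cell is a caret, and its removal gives \<open>T\<close>.\<close>

lemma caret_cell:
  assumes "spans lo hi i L" "([e], [x, y]) \<in> cells L"
    and "lo x = i + j" "hi x = Suc (i + j)" "hi y = Suc (Suc (i + j))"
  shows "\<exists>T. shape L = subst T (caret_at (tips T) j) \<and> tips (shape L) = Suc (tips T)"
  using assms
proof (induction L arbitrary: i j)
  case (LFork f l r)
  have sp: "spans lo hi i l" "spans lo hi (i + tips (shape l)) r" using LFork.prems by auto
  have tip: "T = Tip" if "tips T = 1" for T
    using that tips_pos by (cases T) (auto simp: add_is_1 simp del: length_greater_0_conv length_0_conv)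
  consider "x = root_edge l" "y = root_edge r" | "([e], [x, y]) \<in> cells l" | "([e], [x, y]) \<in> cells r"
    using LFork.prems(2) by auto
  then show ?case
  proof cases
    case 1
    then have "j = 0" "tips (shape l) = 1" "tips (shape r) = 1"
      using spans_root[OF sp(1)] spans_root[OF sp(2)] LFork.prems by simp_all
    then show ?thesis using tip by (intro exI[of _ Tip]) (auto simp: caret_at_def)
  next
    case 2
    then obtain T where T: "shape l = subst T (caret_at (tips T) j)" "tips (shape l) = Suc (tips T)"
      using LFork.IH(1)[OF sp(1)] LFork.prems by blast
    have "y \<in> set_ltree l" using cells_in_set[OF 2] by auto
    then have j: "j < tips T" using spans_range[OF sp(1), of y] LFork.prems(5) T(2) by simp
    have "take (tips T) (caret_at (tips (Fork T (shape r))) j) = caret_at (tips T) j"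
      "drop (tips T) (caret_at (tips (Fork T (shape r))) j) = replicate (tips (shape r)) Tip"
      using j by (simp_all add: caret_at_def take_update_swap drop_update_cancel)
    then show ?thesis using T by (intro exI[of _ "Fork T (shape r)"]) simp
  next
    case 3
    have "x \<in> set_ltree r" using cells_in_set[OF 3] by auto
    then have j: "tips (shape l) \<le> j" using spans_range[OF sp(2), of x] LFork.prems(3) by simp
    define j' where "j' = j - tips (shape l)"
    then obtain T where T: "shape r = subst T (caret_at (tips T) j')" "tips (shape r) = Suc (tips T)"
      using LFork.IH(2)[OF sp(2) 3, of j'] LFork.prems j by auto
    have "take (tips (shape l)) (caret_at (tips (Fork (shape l) T)) j) = replicate (tips (shape l)) Tip"
      "drop (tips (shape l)) (caret_at (tips (Fork (shape l) T)) j) = caret_at (tips T) j'"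
      using j by (simp_all add: caret_at_def drop_update_swap j'_def)
    then show ?thesis using T by (intro exI[of _ "Fork (shape l) T"]) simp
  qed
qed simp

context tree_pair_diagram
begin

text \<open>The bottom edges of the first kind of dipole belong to both trees, so they are leaves and form
  a caret at the same place of both trees. The second kind cannot occur: its middle edge belongs to both
  trees but is not a leaf.\<close>

lemma dipole_common_caret:
  assumes "has_dipole D"
  shows "\<exists>S T j. shape L1 = subst S (caret_at (tips S) j) \<and> shape L2 = subst T (caret_at (tips T) j) \<and>
    tips S = tips T \<and> tips S < tips (shape L1)"
proof -
  have single: "\<exists>e x y. c = ([e], [x, y])" if "c \<in> cells L" for c and L :: "'e ltree"
    using that by (induction L) auto
  have down: "([e], [x, y]) \<in> cells L1" if "([e], [x, y]) \<in> dcells D" for e x y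
    using that single[of "([x, y], [e])" L2] unfolding dcells_eq by auto
  have up: "([e], [x, y]) \<in> cells L2" if "([x, y], [e]) \<in> dcells D" for e x y
    using that single[of "([x, y], [e])" L1] unfolding dcells_eq by auto
  have leaf: "hi a = Suc (lo a)" if "a \<in> set_ltree L1" "a \<in> set_ltree L2" for a
    using rank_leaf[of a] shared that by auto
  from assms consider e x y e' where "([e], [x, y]) \<in> cells L1" "([e'], [x, y]) \<in> cells L2"
    | e x y x' y' where "([e], [x, y]) \<in> cells L2" "([e], [x', y']) \<in> cells L1"
    unfolding has_dipole_def using down up by blast
  then show ?thesis
  proof cases
    case (1 e x y e')
    have "x \<in> set_ltree L1" "y \<in> set_ltree L1" "x \<in> set_ltree L2" "y \<in> set_ltree L2"
      using cells_in_set[OF 1(1)] cells_in_set[OF 1(2)] by auto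
    then have xy: "hi x = Suc (lo x)" "hi y = Suc (Suc (lo x))"
      using leaf[of x] leaf[of y] spans_cells[OF spans1 1(1)] by simp_all
    obtain S where S: "shape L1 = subst S (caret_at (tips S) (lo x))" "N = Suc (tips S)"
      using caret_cell[OF spans1 1(1), of "lo x"] xy by auto
    obtain T where T: "shape L2 = subst T (caret_at (tips T) (lo x))" "N = Suc (tips T)"
      using caret_cell[OF spans2 1(2), of "lo x"] xy N_eq by auto
    show ?thesis using S T by (intro exI[of _ S] exI[of _ T] exI[of _ "lo x"]) auto
  next
    case (2 e x y x' y')
    have "e \<in> set_ltree L1" "e \<in> set_ltree L2" using cells_in_set[OF 2(1)] cells_in_set[OF 2(2)] by auto
    then have False using leaf[of e] spans_cells[OF spans1 2(2)] by linarith
    then show ?thesis ..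
  qed
qed

end

lemma cas_chained:
  assumes "es \<noteq> []" "chained (tail G) (head G) es"
  shows "pre_digraph.cas G (tail G (hd es)) es (head G (last es))"
  using assms
proof (induction es rule: list_nonempty_induct)
  case (cons e es)
  then show ?case by (cases es) (auto simp: chained_def pre_digraph.cas.simps)
qed (simp add: pre_digraph.cas.simps)

text \<open>Among the tree pairs of \<open>f\<close> one with the fewest leaves is chosen. Its diagram is reduced,
  since a common caret could be removed.\<close>

lemma tree_group_subset_jones: "tree_group m \<subseteq> jones_subgroup m"
proof
  fix f assume "f \<in> tree_group m"
  then obtain S0 T0 where "tree_rep m f S0 T0" by (auto simp: tree_group_def)
  then obtain S where "\<exists>T. tree_rep m f S T"
    and min: "\<And>S'. \<exists>T'. tree_rep m f S' T' \<Longrightarrow> tips S \<le> tips S'"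
    using ex_has_least_nat[of "\<lambda>S. \<exists>T. tree_rep m f S T" S0 tips] by blast
  then obtain T where f: "tree_rep m f S T" by blast
  have k: "tips T = tips S" using tree_rep_tips[OF f] by simp
  let ?t = name_tail and ?h = name_head
  define L1 L2 where "L1 = name_tree 0 0 S" and "L2 = name_tree 1 0 T"
  have sp: "spans ?t ?h 0 L1" "spans ?t ?h 0 L2" by (simp_all add: L1_def L2_def spans_name_tree)
  have sh [simp]: "shape L1 = S" "shape L2 = T" by (simp_all add: L1_def L2_def)
  have same: "leaves L2 = leaves L1" by (simp add: L1_def L2_def leaves_name_tree k)
  define Dp Dm where "Dp = tree_diag ?t ?h L1" and "Dm = dinv (tree_diag ?t ?h L2)"
  have d: "diagram Dp" "diagram Dm"
    using diagram_tree_diag[OF sp(1)] diagram_tree_diag[OF sp(2)] by (auto simp: Dp_def Dm_def intro: diagram.inv)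
  have fp: "forest_diag Dp [L1]" and fm: "forest_diag (dinv Dm) [L2]"
    using tree_diag_forest[OF sp(1)] tree_diag_forest[OF sp(2)] by (simp_all add: Dp_def Dm_def)
  have ch: "chained ?t ?h (leaves L1)" using aligned_leaves[OF spans_imp_aligned[OF sp(1)]] by simp
  have comp: "composable_diags Dp Dm"
    unfolding composable_diags_def
  proof (intro conjI)
    have "path_verts Dp (leaves L1) = set (edge_verts ?t ?h (leaves L1))"
      using path_verts_eq[of "leaves L1" Dp] ch by (simp add: Dp_def tree_diag_def)
    then show "verts (dgraph Dp) \<inter> verts (dgraph Dm) = path_verts Dp (dbot Dp)"
      by (simp add: Dp_def Dm_def tree_diag_def same)
    have "set_ltree L1 \<inter> set_ltree L2 = set (leaves L1)"
      using name_tree_shared[of S T] leaves_subset[of L1] leaves_subset[of L2] same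
      unfolding L1_def[symmetric] L2_def[symmetric] by auto
    then show "arcs (dgraph Dp) \<inter> arcs (dgraph Dm) = set (dbot Dp)"
      by (simp add: Dp_def Dm_def tree_diag_def)
  qed (simp_all add: Dp_def Dm_def tree_diag_def compatible_def same)
  define D where "D = dcomp Dp Dm"
  obtain pos where "tree_pair_diagram D L1 L2 pos"
    using tree_pair_diagram_exists[OF fp fm comp] D_def by blast
  then interpret tree_pair_diagram D L1 L2 pos .
  have th: "tail (dgraph D) = ?t" "head (dgraph D) = ?h"
    by (simp_all add: D_def dcomp_def Digraph_Component.union_def Dp_def tree_diag_def)
  have "diagram_in_F D"
    using diagram.comp[OF d comp] top bot by (simp add: diagram_in_F_def D_def)
  moreover have "reduced D"
  proof (rule ccontr)
    assume "\<not> reduced D"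
    then obtain S' T' j where c: "S = subst S' (caret_at (tips S') j)" "T = subst T' (caret_at (tips T') j)"
        "tips S' = tips T'" "tips S' < tips S"
      using dipole_common_caret by (auto simp: reduced_def)
    have "tree_rep m f S' T'"
      using f c(1-3) tree_rep_subst_iff[of "caret_at (tips S') j" S' T' m f] by (simp add: caret_at_def)
    then show False using min c(4) by fastforce
  qed
  moreover have "good m D" using good_iff f tree_rep_iff_labels[of m f S T] by simp
  moreover have "corresponds D f"
    unfolding corresponds_def
  proof (rule conjI, goal_cases)
    case 1
    show "f \<in> extensional {0..1}" using f by (simp add: tree_rep_def)
  next
    case 2
    show ?case
    proof (rule exI[of _ Dp], rule exI[of _ Dm], intro conjI ballI)
    have "longest_positive_path D (leaves L1)"
      unfolding longest_positive_path_def
    proof (intro conjI allI impI)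
      have "?t (hd (leaves L1)) = dinit D" "?h (last (leaves L1)) = dterm D"
        using aligned_leaves[OF spans_imp_aligned[OF sp(1)]] by (simp_all add: dinit_def dterm_def top th)
      then have "pre_digraph.cas (dgraph D) (dinit D) (leaves L1) (dterm D)"
        using cas_chained[of "leaves L1" "dgraph D"] ch th by simp
      then show "pre_digraph.awalk (dgraph D) (dinit D) (leaves L1) (dterm D)"
        using init leaves_subset[of L1] arcs_eq by (auto simp: pre_digraph.awalk_def)
      fix q assume "pre_digraph.awalk (dgraph D) (dinit D) q (dterm D)"
      then show "length q \<le> length (leaves L1)"
        using cas_length[of q "dinit D" "dterm D"] init dterm by (simp add: pre_digraph.awalk_def)
    qed
    then show "diagram_cut D Dp Dm"
      using d comp by (simp add: diagram_cut_def D_def Dp_def tree_diag_def)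
    fix e assume "e \<in> set (dbot Dp)"
    then obtain j where j: "j < tips S" "e = leaves L1 ! j"
      by (auto simp: Dp_def tree_diag_def in_set_conv_nth)
    define v w where "v = addr S ! j" and "w = addr T ! j"
    have "assigned Dp e (act v 0) (act v 1)" using forest_assigned[OF fp, of j] j by (simp add: v_def)
    moreover have "assigned (dinv Dm) e (act w 0) (act w 1)"
      using forest_assigned[OF fm, of j] j k same by (simp add: w_def)
    moreover have "f x = act w 0 + (act w 1 - act w 0) / (act v 1 - act v 0) * (x - act v 0)"
      if "x \<in> {act v 0..act v 1}" for x
    proof -
      have "act v 0 \<le> x" "x \<le> act v 1" using that by auto
      then obtain s where s: "s \<in> {0..1}" "x = act v s" by (rule act_between)
      have "f x = act w s" using tree_rep_nth[OF f j(1) s(1)] s(2) by (simp add: v_def w_def)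
      moreover have "act v 1 - act v 0 \<noteq> 0" by simp
      moreover have "x - act v 0 = (act v 1 - act v 0) * s" using act_convex[of v s] s by simp
      ultimately show ?thesis using act_convex[of w s] by (simp del: act_eq_iff)
    qed
    ultimately show "\<exists>a b c d. assigned Dp e a b \<and> assigned (dinv Dm) e c d \<and>
        (\<forall>t\<in>{a..b}. f t = c + (d - c) / (b - a) * (t - a))" by blast
    qed
  qed
  ultimately show "f \<in> jones_subgroup m" unfolding jones_subgroup_def by blast
qed

theorem lemma5p6:
  fixes n :: nat
  assumes "n \<ge> 2"
  shows "jones_subgroup (n - 1) = H_group n"
  using jones_subgroup_subset tree_group_subset_jones H_group_eq_tree_group[OF assms] by blast

end
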